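(* Let $p\ge3$, $X\mid\theta\sim N_p(\theta,D)$ with $D=\operatorname{diag}(d_1,\ldots,d_p)$, $d_j>0$, and let the prior be $\theta\sim N(0,\Gamma)$ with $\Gamma=\operatorname{diag}(\gamma_1,\ldots,\gamma_p)$, $\gamma_j\ge0$. Let $d_j^*=d_j^2/(d_j+\gamma_j)$ with indices sorted so that $d_1^*\ge\cdots\ge d_p^*$. Let $A^\dagger=\operatorname{diag}(a_1^\dagger,\ldots,a_p^\dagger)$ be the unique maximizer of $c^*(D,A)=\sum_j d_ja_j-2\max_j d_ja_j$ over $a_j\ge0$ with $\sum_j(d_j+\gamma_j)a_j^2=\sum_j d_j^*$, let $\nu$ be the largest index with $d_\nu a_\nu^\dagger=\max_j d_ja_j^\dagger$, and let $\delta_{A^\dagger(\Gamma)}(X)=X-\frac{c^*(D,A^\dagger)}{X^\top A^{\dagger\top}A^\dagger X}A^\dagger X$. Denote by $R(\delta,\pi_\Gamma)=E^{\pi_\Gamma}E_\theta\|\delta(X)-\theta\|^2$ the Bayes risk. If $\nu=3$, then \[ R\{\delta_{A^\dagger(\Gamma)},\pi_\Gamma\}\le\operatorname{tr}(D)-\sum_{j=3}^p d_j^*+\Big(d_3^*-\frac{2}{p-2}\sum_{j=4}^pd_j^*-\frac{p}{p-2}\frac{d_3^*}{3}\Big)\le\operatorname{tr}(D)-\sum_{j=3}^p d_j^*+\frac23d_3^*. \] If $\nu\ge4$, then \[ R\{\delta_{A^\dagger(\Gamma)},\pi_\Gamma\}\le\operatorname{tr}(D)-\sum_{j=3}^p d_j^*+\Big(d_3^*+d_4^*-\frac{2}{p-2}\sum_{j=5}^pd_j^*-\frac{4p}{p-2}\frac{d_\nu^*}{\nu}\Big)\le\operatorname{tr}(D)-\sum_{j=3}^p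 d_j^*+(d_3^*+d_4^* ). \]
   Context: The maximizer $A^\dagger$ exists and is unique. An empty summation is $0$. $E^{\pi_\Gamma}$ denotes expectation over $\theta\sim N(0,\Gamma)$ and $E_\theta$ expectation over $X\sim N(\theta,D)$. *)

theory Defs
  imports "HOL-Probability.Probability"
begin

definition normal_meas :: "real \<Rightarrow> real \<Rightarrow> real measure" where
  "normal_meas m v = (if v = 0 then return lborel m
                      else density lborel (normal_density m (sqrt v)))"

definition gauss_diag :: "nat \<Rightarrow> (nat \<Rightarrow> real) \<Rightarrow> (nat \<Rightarrow> real) \<Rightarrow> (nat \<Rightarrow> real) measure" where
  "gauss_diag p m v = PiM {1..p} (\<lambda>j. normal_meas (m j) (v j))"

definition bayes_risk ::
  "nat \<Rightarrow> (nat \<Rightarrow> real) \<Rightarrow> (nat \<Rightarrow> real) \<Rightarrow> ((nat \<Rightarrow> real) \<Rightarrow> (nat \<Rightarrow> real)) \<Rightarrow> ennreal" where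
  "bayes_risk p d \<gamma> \<delta> =
     (\<integral>\<^sup>+ \<theta>. (\<integral>\<^sup>+ x. ennreal (\<Sum>j\<in>{1..p}. (\<delta> x j - \<theta> j)\<^sup>2) \<partial>gauss_diag p \<theta> d)
        \<partial>gauss_diag p (\<lambda>_. 0) \<gamma>)"

definition dstar :: "(nat \<Rightarrow> real) \<Rightarrow> (nat \<Rightarrow> real) \<Rightarrow> nat \<Rightarrow> real" where
  "dstar d \<gamma> j = d j ^ 2 / (d j + \<gamma> j)"

definition cstar :: "nat \<Rightarrow> (nat \<Rightarrow> real) \<Rightarrow> (nat \<Rightarrow> real) \<Rightarrow> real" where
  "cstar p d a = (\<Sum>j\<in>{1..p}. d j * a j) - 2 * Max ((\<lambda>j. d j * a j) ` {1..p})"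

definition feasible :: "nat \<Rightarrow> (nat \<Rightarrow> real) \<Rightarrow> (nat \<Rightarrow> real) \<Rightarrow> (nat \<Rightarrow> real) \<Rightarrow> bool" where
  "feasible p d \<gamma> a \<longleftrightarrow> (\<forall>j\<in>{1..p}. a j \<ge> 0) \<and>
     (\<Sum>j\<in>{1..p}. (d j + \<gamma> j) * (a j)\<^sup>2) = (\<Sum>j\<in>{1..p}. dstar d \<gamma> j)"

definition nu_idx :: "nat \<Rightarrow> (nat \<Rightarrow> real) \<Rightarrow> (nat \<Rightarrow> real) \<Rightarrow> nat" where
  "nu_idx p d a = (GREATEST k. k \<in> {1..p} \<and> d k * a k = Max ((\<lambda>j. d j * a j) ` {1..p}))"

definition delta_A :: "nat \<Rightarrow> (nat \<Rightarrow> real) \<Rightarrow> (nat \<Rightarrow> real) \<Rightarrow> (nat \<Rightarrow> real) \<Rightarrow> (nat \<Rightarrow> real)" where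
  "delta_A p d a x = (\<lambda>j. x j - cstar p d a / (\<Sum>k\<in>{1..p}. (a k * x k)\<^sup>2) * (a j * x j))"

end

theory Submission
  imports Defs "HOL-Real_Asymp.Real_Asymp"
begin

text \<open>
  Writing everything in terms of standard normal variables and rotating each pair of coordinates
  (prior noise, sampling noise) so that \<open>X\<close> depends on one of the two only, the Bayes risk becomes
  \<open>tr D - 2 c E[\<Sum>j. b\<^sub>j g\<^sub>j\<^sup>2 / S] + c\<^sup>2 E[1 / S]\<close> with \<open>b\<^sub>j = d\<^sub>j a\<^sub>j\<close>, \<open>s\<^sub>j = (d\<^sub>j + \<gamma>\<^sub>j) a\<^sub>j\<^sup>2\<close> and
  \<open>S = \<Sum>j. s\<^sub>j g\<^sub>j\<^sup>2\<close>. Stein's identity bounds this by \<open>tr D - c\<^sup>2 E[1 / S]\<close>, and convexity of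
  \<open>1 / x\<close> together with exchangeability gives \<open>E[1 / S] \<ge> p / ((p - 2) \<Sum>j. s\<^sub>j)\<close>.
  The maximizer has the form \<open>b\<^sub>j = min M (\<lambda> d\<^sub>j\<^sup>*)\<close>, so that \<open>c\<^sup>2 / \<Sum>j. s\<^sub>j\<close> equals
  \<open>(\<nu> - 2)\<^sup>2 / (\<Sum>j\<le>\<nu>. 1 / d\<^sub>j\<^sup>*) + (\<Sum>j>\<nu>. d\<^sub>j\<^sup>*)\<close>, which is bounded below by induction on \<open>\<nu>\<close>.
\<close>

subsection \<open>Gaussian measures as images of standard normals\<close>

text \<open>The rotation is the posterior decomposition: its first coordinate is the standardised
  observation, its second is the posterior noise of \<open>\<theta> j\<close>, independent of
  \<open>X\<close>. Working with images of standard normals instead of conditional densities covers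
  \<open>\<gamma> j = 0\<close>, where the prior of a coordinate is a point mass. The analytic
  obstacle is the singularity of \<open>1 / S\<close> at 0. Stein's identity is therefore first
  proved with denominator \<open>S + e\<close>, where all integrands are bounded. Dimension three
  enters as positivity of \<open>p - 2\<close> in a bound on \<open>E[1 / (R + e)]\<close>,
  \<open>R\<close> the squared norm, that is uniform in \<open>e\<close>; it yields integrability at
  \<open>e = 0\<close>. The maximum in \<open>cstar\<close> makes the objective nonsmooth, so the
  maximizer is found by varying one coordinate below the current maximum rather than by derivatives.
  The constants of the theorem come from \<open>(\<nu> - 2)\<^sup>2\<close> at the smallest index of
  each case: 1 at \<open>\<nu> = 3\<close> and 4 at \<open>\<nu> = 4\<close>.\<close>

definition stdn :: "real measure" where
  "stdn = density lborel std_normal_density"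

lemma sets_stdn [simp, measurable_cong]: "sets stdn = sets borel"
  by (simp add: stdn_def)

lemma space_stdn [simp]: "space stdn = UNIV"
  by (simp add: stdn_def)

interpretation stdn: prob_space stdn
  unfolding stdn_def by (rule prob_space_normal_density) simp

interpretation gstd: product_prob_space "\<lambda>_. stdn" UNIV
  by unfold_locales

text \<open>Variance 0 is covered as well: the map is then constant and its image measure is the
  point mass that \<open>normal_meas\<close> prescribes. This spares later arguments a case split on
  \<open>\<gamma> j = 0\<close>.\<close>

lemma normal_meas_eq_distr_stdn:
  assumes "v \<ge> 0"
  shows "normal_meas m v = distr stdn lborel (\<lambda>z. m + sqrt v * z)"
proof (cases "v = 0")
  case True
  have "distr stdn lborel (\<lambda>z. m) = return lborel m"
    by (rule stdn.distr_const) simp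
  with True show ?thesis by (simp add: normal_meas_def)
next
  case False
  with assms have v: "sqrt v \<noteq> 0" "v \<noteq> 0" "sqrt v \<ge> 0" by auto
  have "distributed stdn lborel (\<lambda>x. x) std_normal_density"
    by (simp add: distributed_def stdn_def distr_id2)
  from stdn.normal_density_affine[OF this _ v(1), of m]
  have "distr stdn lborel (\<lambda>z. m + sqrt v * z) = density lborel (normal_density m (sqrt v))"
    using v by (simp add: distributed_def)
  with v show ?thesis by (simp add: normal_meas_def)
qed

lemma gauss_diag_eq_distr_stdn:
  assumes "\<And>j. j \<in> {1..p} \<Longrightarrow> v j \<ge> 0"
  shows "gauss_diag p m v = distr (PiM {1..p} (\<lambda>_. stdn)) (PiM {1..p} (\<lambda>_. lborel))
           (\<lambda>z. \<lambda>j\<in>{1..p}. m j + sqrt (v j) * z j)" (is "_ = distr ?P ?L ?f")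
proof -
  define N where "N j = distr stdn lborel (\<lambda>z. m j + sqrt (v j) * z)" for j
  have [simp, measurable_cong]: "sets (N j) = sets lborel" for j by (simp add: N_def)
  have "prob_space (N j)" for j
    unfolding N_def by (rule stdn.prob_space_distr) simp
  then interpret N: product_prob_space N UNIV
    by (intro product_prob_spaceI)
  have "distr ?P ?L ?f = PiM {1..p} N"
  proof (rule N.PiM_eqI)
    show "sets (distr ?P ?L ?f) = sets (Pi\<^sub>M {1..p} N)"
      by (simp cong: sets_PiM_cong)
    fix A :: "nat \<Rightarrow> real set" assume A: "\<And>i. i \<in> {1..p} \<Longrightarrow> A i \<in> sets (N i)"
    have [measurable]: "?f \<in> measurable ?P ?L" by measurable
    have *: "?f -` Pi\<^sub>E {1..p} A \<inter> space ?P =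
        Pi\<^sub>E {1..p} (\<lambda>j. (\<lambda>z. m j + sqrt (v j) * z) -` A j)"
      by (auto simp: space_PiM PiE_iff)
    have B: "(\<lambda>z. m j + sqrt (v j) * z) -` A j \<in> sets stdn" if "j \<in> {1..p}" for j
      using measurable_sets[of "\<lambda>z. m j + sqrt (v j) * z" stdn lborel "A j"] A[OF that] by simp
    have "emeasure (distr ?P ?L ?f) (Pi\<^sub>E {1..p} A) =
        emeasure ?P (Pi\<^sub>E {1..p} (\<lambda>j. (\<lambda>z. m j + sqrt (v j) * z) -` A j))"
      unfolding *[symmetric] by (rule emeasure_distr) (use A in \<open>auto intro!: sets_PiM_I_finite\<close>)
    also have "\<dots> = (\<Prod>j\<in>{1..p}. emeasure stdn ((\<lambda>z. m j + sqrt (v j) * z) -` A j))"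
      by (rule gstd.emeasure_PiM) (use B in auto)
    also have "\<dots> = (\<Prod>j\<in>{1..p}. emeasure (N j) (A j))"
      by (intro prod.cong refl) (use A in \<open>auto simp: N_def emeasure_distr\<close>)
    finally show "emeasure (distr ?P ?L ?f) (Pi\<^sub>E {1..p} A) = (\<Prod>j\<in>{1..p}. emeasure (N j) (A j))" .
  qed simp_all
  moreover have "gauss_diag p m v = PiM {1..p} N"
    unfolding gauss_diag_def N_def
    by (intro PiM_cong refl normal_meas_eq_distr_stdn assms)
  ultimately show ?thesis by simp
qed

section \<open>Orthogonal invariance of independent standard normals\<close>

lemma std_normal_density_rotate:
  assumes "c\<^sup>2 + s\<^sup>2 = 1"
  shows "std_normal_density (c * x + s * y) * std_normal_density (s * x - c * y) =
    std_normal_density x * std_normal_density y"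
proof -
  have "(c * x + s * y)\<^sup>2 + (s * x - c * y)\<^sup>2 = (c\<^sup>2 + s\<^sup>2) * (x\<^sup>2 + y\<^sup>2)"
    by (simp add: power2_eq_square algebra_simps)
  also have "\<dots> = x\<^sup>2 + y\<^sup>2" using assms by simp
  finally have eq: "(c * x + s * y)\<^sup>2 + (s * x - c * y)\<^sup>2 = x\<^sup>2 + y\<^sup>2" .
  have "exp (- (c * x + s * y)\<^sup>2 / 2) * exp (- (s * x - c * y)\<^sup>2 / 2) = exp (- x\<^sup>2 / 2) * exp (- y\<^sup>2 / 2)"
    unfolding exp_add[symmetric] using eq by (simp add: field_simps)
  then show ?thesis
    by (simp add: std_normal_density_def field_simps)
qed

text \<open>The matrix with rows \<open>(c, s)\<close> and \<open>(s, - c)\<close> is a reflection,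
  hence its own inverse, and preserves the joint density. The change of variables is done one real
  variable at a time with Tonelli in between, and the Jacobian factors \<open>1 / s\<close> and
  \<open>s\<close> cancel. Positivity is asked of \<open>s\<close> because \<open>s\<close> will
  carry the sampling variance, while \<open>c\<close> is 0 in a coordinate with prior variance
  0.\<close>

lemma stdn_rotation_invariant:
  fixes F :: "real \<Rightarrow> real \<Rightarrow> ennreal"
  assumes [measurable]: "case_prod F \<in> borel_measurable (borel \<Otimes>\<^sub>M borel)"
    and cs: "c\<^sup>2 + s\<^sup>2 = 1" and s: "s > 0"
  shows "(\<integral>\<^sup>+ x. \<integral>\<^sup>+ y. F x y \<partial>stdn \<partial>stdn) =
    (\<integral>\<^sup>+ x. \<integral>\<^sup>+ y. F (c * x + s * y) (s * x - c * y) \<partial>stdn \<partial>stdn)"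
proof -
  let ?\<phi> = "\<lambda>x. ennreal (std_normal_density x)"
  have c1: "c * c = 1 - s * s" using cs by (simp add: power2_eq_square algebra_simps)
  have [measurable]: "(\<lambda>y. F (c * x + s * y) (s * x - c * y)) \<in> borel_measurable borel" for x
    by measurable
  have m1: "(\<lambda>x. \<integral>\<^sup>+ y. ?\<phi> y * F (c * x + s * y) (s * x - c * y) \<partial>lborel) \<in> borel_measurable borel"
    by measurable
  have m2: "(\<lambda>x. \<integral>\<^sup>+ y. ?\<phi> y * F x y \<partial>lborel) \<in> borel_measurable borel"
    by measurable
  have "(\<integral>\<^sup>+ x. \<integral>\<^sup>+ y. F (c * x + s * y) (s * x - c * y) \<partial>stdn \<partial>stdn) =
     (\<integral>\<^sup>+ x. ?\<phi> x * (\<integral>\<^sup>+ y. ?\<phi> y * F (c * x + s * y) (s * x - c * y) \<partial>lborel) \<partial>lborel)"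
    unfolding stdn_def using m1 by (simp add: nn_integral_density)
  also have "\<dots> = (\<integral>\<^sup>+ x. (\<integral>\<^sup>+ y. ?\<phi> x * ?\<phi> y * F (c * x + s * y) (s * x - c * y) \<partial>lborel) \<partial>lborel)"
    by (intro nn_integral_cong) (simp add: nn_integral_cmult[symmetric] mult.assoc)
  \<comment> \<open>Substitute \<open>u = c * x + s * y\<close> at fixed \<open>x\<close>; then
    \<open>s * x - c * y = (x - c * u) / s\<close> because
    \<open>c\<^sup>2 + s\<^sup>2 = 1\<close>.\<close>
  also have "\<dots> = (\<integral>\<^sup>+ x. (\<integral>\<^sup>+ u. ennreal (1 / s) * (?\<phi> x * ?\<phi> ((u - c * x) / s) * F u ((x - c * u) / s)) \<partial>lborel) \<partial>lborel)"
  proof (rule nn_integral_cong)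
    fix x :: real
    have "(\<integral>\<^sup>+ y. ?\<phi> x * ?\<phi> y * F (c * x + s * y) (s * x - c * y) \<partial>lborel)
       = ennreal \<bar>1 / s\<bar> * (\<integral>\<^sup>+ u. ?\<phi> x * ?\<phi> (- c * x / s + 1 / s * u) *
           F (c * x + s * (- c * x / s + 1 / s * u)) (s * x - c * (- c * x / s + 1 / s * u)) \<partial>lborel)"
      using s by (intro nn_integral_real_affine) auto
    also have "\<dots> = ennreal (1 / s) * (\<integral>\<^sup>+ u. ?\<phi> x * ?\<phi> ((u - c * x) / s) * F u ((x - c * u) / s) \<partial>lborel)"
    proof -
      have "c * x + s * (- c * x / s + 1 / s * u) = u" "- c * x / s + 1 / s * u = (u - c * x) / s" 
        "s * x - c * (- c * x / s + 1 / s * u) = (x - c * u) / s" for u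
      proof -
        have "s * (s * x - c * (- c * x / s + 1 / s * u)) = s * s * x + c * c * x - c * u"
          using s by (simp add: field_simps)
        also have "\<dots> = x - c * u" unfolding c1 by (simp add: algebra_simps)
        finally show "s * x - c * (- c * x / s + 1 / s * u) = (x - c * u) / s"
          using s by (metis nonzero_mult_div_cancel_left less_irrefl)
      qed (use s in \<open>auto simp: field_simps\<close>)
      then show ?thesis using s by simp
    qed
    finally show "(\<integral>\<^sup>+ y. ?\<phi> x * ?\<phi> y * F (c * x + s * y) (s * x - c * y) \<partial>lborel)
      = (\<integral>\<^sup>+ u. ennreal (1 / s) * (?\<phi> x * ?\<phi> ((u - c * x) / s) * F u ((x - c * u) / s)) \<partial>lborel)"
      by (simp add: nn_integral_cmult)
  qed
  also have "\<dots> = (\<integral>\<^sup>+ u. (\<integral>\<^sup>+ x. ennreal (1 / s) * (?\<phi> x * ?\<phi> ((u - c * x) / s) * F u ((x - c * u) / s)) \<partial>lborel) \<partial>lborel)"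
    by (rule lborel_pair.Fubini') measurable
  \<comment> \<open>Now \<open>u\<close> is fixed and \<open>x = c * u + s * w\<close>, the first
    row of the inverse reflection.\<close>
  also have "\<dots> = (\<integral>\<^sup>+ u. (\<integral>\<^sup>+ w. ?\<phi> u * ?\<phi> w * F u w \<partial>lborel) \<partial>lborel)"
  proof (rule nn_integral_cong)
    fix u :: real
    have "(\<integral>\<^sup>+ x. ennreal (1 / s) * (?\<phi> x * ?\<phi> ((u - c * x) / s) * F u ((x - c * u) / s)) \<partial>lborel)
      = ennreal \<bar>s\<bar> * (\<integral>\<^sup>+ w. ennreal (1 / s) * (?\<phi> (c * u + s * w) * ?\<phi> ((u - c * (c * u + s * w)) / s) *
          F u ((c * u + s * w - c * u) / s)) \<partial>lborel)"
      using s by (intro nn_integral_real_affine) auto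
    also have "\<dots> = (\<integral>\<^sup>+ w. ennreal s * (ennreal (1 / s) * (?\<phi> (c * u + s * w) * ?\<phi> ((u - c * (c * u + s * w)) / s) *
          F u ((c * u + s * w - c * u) / s))) \<partial>lborel)"
      using s by (simp add: nn_integral_cmult)
    also have "\<dots> = (\<integral>\<^sup>+ w. ?\<phi> u * ?\<phi> w * F u w \<partial>lborel)"
    proof (intro nn_integral_cong)
      fix w :: real
      have e: "(u - c * (c * u + s * w)) / s = s * u - c * w"
      proof -
        have "u - c * (c * u + s * w) = u - (c * c) * u - c * s * w" by (simp add: algebra_simps)
        also have "\<dots> = s * (s * u - c * w)" unfolding c1 by (simp add: algebra_simps)
        finally show ?thesis using s by simp
      qed
      have r: "?\<phi> (c * u + s * w) * ?\<phi> (s * u - c * w) = ?\<phi> u * ?\<phi> w"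
        using std_normal_density_rotate[OF cs, of u w] by (simp add: ennreal_mult'[symmetric])
      have k: "ennreal s * ennreal (1 / s) = 1" using s by (simp add: ennreal_mult'[symmetric])
      show "ennreal s * (ennreal (1 / s) * (?\<phi> (c * u + s * w) * ?\<phi> ((u - c * (c * u + s * w)) / s) *
          F u ((c * u + s * w - c * u) / s))) = ?\<phi> u * ?\<phi> w * F u w"
        unfolding e r mult.assoc[symmetric] k using s by simp
    qed
    finally show "(\<integral>\<^sup>+ x. ennreal (1 / s) * (?\<phi> x * ?\<phi> ((u - c * x) / s) * F u ((x - c * u) / s)) \<partial>lborel)
       = (\<integral>\<^sup>+ w. ?\<phi> u * ?\<phi> w * F u w \<partial>lborel)" .
  qed
  also have "\<dots> = (\<integral>\<^sup>+ x. ?\<phi> x * (\<integral>\<^sup>+ y. ?\<phi> y * F x y \<partial>lborel) \<partial>lborel)"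
    by (intro nn_integral_cong) (simp add: nn_integral_cmult[symmetric] mult.assoc)
  also have "\<dots> = (\<integral>\<^sup>+ x. \<integral>\<^sup>+ y. F x y \<partial>stdn \<partial>stdn)"
    unfolding stdn_def using m2 by (simp add: nn_integral_density)
  finally show ?thesis ..
qed

lemma prob_space_PiM_stdn: "prob_space (PiM I (\<lambda>_. stdn))"
  by (intro prob_space_PiM stdn.prob_space_axioms)

lemma sets_PiM_stdn [measurable_cong]: "sets (PiM I (\<lambda>_. stdn)) = sets (PiM I (\<lambda>_. borel))"
  by (intro sets_PiM_cong) auto

text \<open>Grouping the variables into two pairs turns the four-fold exchange into one use of
  Tonelli on product measures. It serves to carry the coordinate pair split off in an induction past
  the remaining coordinates.\<close>

lemma nn_integral_swap_pairs:
  fixes H :: "'a \<Rightarrow> 'a \<Rightarrow> 'b \<Rightarrow> 'b \<Rightarrow> ennreal"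
  assumes "sigma_finite_measure A" "sigma_finite_measure B"
    and H [measurable]: "(\<lambda>z. H (fst (fst z)) (snd (fst z)) (fst (snd z)) (snd (snd z))) \<in> borel_measurable ((A \<Otimes>\<^sub>M A) \<Otimes>\<^sub>M (B \<Otimes>\<^sub>M B))"
  shows "(\<integral>\<^sup>+ x. \<integral>\<^sup>+ y. \<integral>\<^sup>+ t. \<integral>\<^sup>+ u. H x y t u \<partial>B \<partial>B \<partial>A \<partial>A) = (\<integral>\<^sup>+ t. \<integral>\<^sup>+ u. \<integral>\<^sup>+ x. \<integral>\<^sup>+ y. H x y t u \<partial>A \<partial>A \<partial>B \<partial>B)"
proof -
  interpret A: sigma_finite_measure A by fact
  interpret B: sigma_finite_measure B by fact
  interpret AA: pair_sigma_finite A A ..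
  interpret BB: pair_sigma_finite B B ..
  interpret AB: pair_sigma_finite "A \<Otimes>\<^sub>M A" "B \<Otimes>\<^sub>M B"
    by (intro pair_sigma_finite.intro AA.sigma_finite_measure_axioms BB.sigma_finite_measure_axioms)
  have H1: "(\<lambda>w. H x y (fst w) (snd w)) \<in> borel_measurable (B \<Otimes>\<^sub>M B)" if "x \<in> space A" "y \<in> space A" for x y
    using measurable_Pair2[OF H, of "(x, y)"] that by (simp add: space_pair_measure)
  have H2: "(\<lambda>z. H (fst z) (snd z) t u) \<in> borel_measurable (A \<Otimes>\<^sub>M A)" if "t \<in> space B" "u \<in> space B" for t u
    using measurable_Pair1[OF H, of "(t, u)"] that by (simp add: space_pair_measure)
  have "(\<integral>\<^sup>+ x. \<integral>\<^sup>+ y. \<integral>\<^sup>+ t. \<integral>\<^sup>+ u. H x y t u \<partial>B \<partial>B \<partial>A \<partial>A) =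
      (\<integral>\<^sup>+ x. \<integral>\<^sup>+ y. \<integral>\<^sup>+ w. H x y (fst w) (snd w) \<partial>(B \<Otimes>\<^sub>M B) \<partial>A \<partial>A)"
    by (intro nn_integral_cong, subst B.nn_integral_fst[symmetric]) (use H1 in auto)
  also have "\<dots> = (\<integral>\<^sup>+ z. \<integral>\<^sup>+ w. H (fst z) (snd z) (fst w) (snd w) \<partial>(B \<Otimes>\<^sub>M B) \<partial>(A \<Otimes>\<^sub>M A))"
    by (subst A.nn_integral_fst[symmetric]) simp_all
  also have "\<dots> = (\<integral>\<^sup>+ w. \<integral>\<^sup>+ z. H (fst z) (snd z) (fst w) (snd w) \<partial>(A \<Otimes>\<^sub>M A) \<partial>(B \<Otimes>\<^sub>M B))"
    by (rule AB.Fubini'[symmetric]) simp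
  also have "\<dots> = (\<integral>\<^sup>+ t. \<integral>\<^sup>+ u. \<integral>\<^sup>+ z. H (fst z) (snd z) t u \<partial>(A \<Otimes>\<^sub>M A) \<partial>B \<partial>B)"
  proof (subst B.nn_integral_fst[symmetric])
    have "(\<lambda>p. H (fst (snd p)) (snd (snd p)) (fst (fst p)) (snd (fst p))) \<in> borel_measurable ((B \<Otimes>\<^sub>M B) \<Otimes>\<^sub>M (A \<Otimes>\<^sub>M A))"
      using measurable_compose[OF measurable_pair_swap' H] by (simp add: split_beta)
    from AA.borel_measurable_nn_integral_fst[OF this]
    show "(\<lambda>w. \<integral>\<^sup>+ z. H (fst z) (snd z) (fst w) (snd w) \<partial>(A \<Otimes>\<^sub>M A)) \<in> borel_measurable (B \<Otimes>\<^sub>M B)"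
      by simp
  qed simp
  also have "\<dots> = (\<integral>\<^sup>+ t. \<integral>\<^sup>+ u. \<integral>\<^sup>+ x. \<integral>\<^sup>+ y. H x y t u \<partial>A \<partial>A \<partial>B \<partial>B)"
    by (intro nn_integral_cong, subst A.nn_integral_fst[symmetric]) (use H2 in auto)
  finally show ?thesis .
qed

text \<open>Splits one coordinate off both vectors at once. The closing exchange puts the new
  variables \<open>t\<close> and \<open>u\<close> next to each other, so that a planar rotation can
  act on them.\<close>

lemma nn_integral_PiM_stdn_insert_pair:
  fixes G :: "('i \<Rightarrow> real) \<Rightarrow> ('i \<Rightarrow> real) \<Rightarrow> ennreal"
  assumes I: "finite I" "i \<notin> I"
    and G: "case_prod G \<in> borel_measurable (PiM (insert i I) (\<lambda>_. borel) \<Otimes>\<^sub>M PiM (insert i I) (\<lambda>_. borel))"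
  defines "P \<equiv> PiM I (\<lambda>_. stdn)" and "Q \<equiv> PiM (insert i I) (\<lambda>_. stdn)"
  shows "(\<integral>\<^sup>+ x. \<integral>\<^sup>+ y. G x y \<partial>Q \<partial>Q) =
      (\<integral>\<^sup>+ x. \<integral>\<^sup>+ y. \<integral>\<^sup>+ t. \<integral>\<^sup>+ u. G (x(i := t)) (y(i := u)) \<partial>stdn \<partial>stdn \<partial>P \<partial>P)"
proof -
  let ?C = "PiM (insert i I) (\<lambda>_. borel :: real measure)"
  note [measurable] = G
  have [measurable_cong]: "sets P = sets (PiM I (\<lambda>_. borel))" "sets Q = sets ?C"
    unfolding P_def Q_def by (rule sets_PiM_stdn)+
  interpret P: prob_space P unfolding P_def by (rule prob_space_PiM_stdn)
  interpret Q: prob_space Q unfolding Q_def by (rule prob_space_PiM_stdn)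
  interpret SP: pair_sigma_finite P stdn ..
  have "(\<integral>\<^sup>+ x. \<integral>\<^sup>+ y. G x y \<partial>Q \<partial>Q) = (\<integral>\<^sup>+ x. \<integral>\<^sup>+ t. \<integral>\<^sup>+ y. G (x(i := t)) y \<partial>Q \<partial>stdn \<partial>P)"
    unfolding Q_def P_def
  proof (rule gstd.product_nn_integral_insert[OF I])
    have "(\<lambda>x. \<integral>\<^sup>+ y. G x y \<partial>Q) \<in> borel_measurable Q" by measurable
    then show "(\<lambda>x. integral\<^sup>N (Pi\<^sub>M (insert i I) (\<lambda>_. stdn)) (G x)) \<in> borel_measurable (Pi\<^sub>M (insert i I) (\<lambda>_. stdn))"
      by (simp add: Q_def)
  qed
  also have "\<dots> = (\<integral>\<^sup>+ x. \<integral>\<^sup>+ t. \<integral>\<^sup>+ y. \<integral>\<^sup>+ u. G (x(i := t)) (y(i := u)) \<partial>stdn \<partial>P \<partial>stdn \<partial>P)"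
  proof (rule nn_integral_cong, rule nn_integral_cong)
    fix x :: "'i \<Rightarrow> real" and t :: real assume x: "x \<in> space P"
    then have "x(i := t) \<in> space ?C" by (auto simp: P_def space_PiM PiE_iff extensional_def)
    then have "(\<lambda>y. G (x(i := t)) y) \<in> borel_measurable ?C"
      using measurable_Pair2[OF G] by simp
    then show "(\<integral>\<^sup>+ y. G (x(i := t)) y \<partial>Q) = (\<integral>\<^sup>+ y. \<integral>\<^sup>+ u. G (x(i := t)) (y(i := u)) \<partial>stdn \<partial>P)"
      unfolding P_def Q_def
      by (intro gstd.product_nn_integral_insert[OF I]) (simp cong: measurable_cong_sets add: sets_PiM_stdn)
  qed
  also have "\<dots> = (\<integral>\<^sup>+ x. \<integral>\<^sup>+ y. \<integral>\<^sup>+ t. \<integral>\<^sup>+ u. G (x(i := t)) (y(i := u)) \<partial>stdn \<partial>stdn \<partial>P \<partial>P)"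
  proof (rule nn_integral_cong, rule SP.Fubini')
    fix x assume x: "x \<in> space P"
    then have [measurable]: "(\<lambda>t. x(i := t)) \<in> measurable borel ?C"
      using measurable_component_update[of x I "\<lambda>_. borel" i] I by (simp add: P_def space_PiM)
    show "(\<lambda>(y, t). \<integral>\<^sup>+ u. G (x(i := t)) (y(i := u)) \<partial>stdn) \<in> borel_measurable (P \<Otimes>\<^sub>M stdn)"
      by measurable
  qed
  finally show ?thesis .
qed

text \<open>Induction over the coordinates: each reflection acts on one pair
  \<open>(x j, y j)\<close> only. \<open>F\<close> is generalised because the hypothesis is applied
  to \<open>F\<close> with one rotated pair already inserted.\<close>

lemma stdn_PiM_rotation_invariant:
  fixes F :: "('i \<Rightarrow> real) \<Rightarrow> ('i \<Rightarrow> real) \<Rightarrow> ennreal"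
  assumes "finite I"
    and "case_prod F \<in> borel_measurable (PiM I (\<lambda>_. borel) \<Otimes>\<^sub>M PiM I (\<lambda>_. borel))"
    and "\<And>j. j \<in> I \<Longrightarrow> (c j)\<^sup>2 + (s j)\<^sup>2 = 1" and "\<And>j. j \<in> I \<Longrightarrow> s j > 0"
  shows "(\<integral>\<^sup>+ x. \<integral>\<^sup>+ y. F x y \<partial>PiM I (\<lambda>_. stdn) \<partial>PiM I (\<lambda>_. stdn)) =
    (\<integral>\<^sup>+ x. \<integral>\<^sup>+ y. F (\<lambda>j\<in>I. c j * x j + s j * y j) (\<lambda>j\<in>I. s j * x j - c j * y j)
       \<partial>PiM I (\<lambda>_. stdn) \<partial>PiM I (\<lambda>_. stdn))"
  using assms
proof (induction I arbitrary: F rule: finite_induct)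
  case empty
  show ?case by (simp add: PiM_empty nn_integral_count_space_finite)
next
  case (insert i I)
  let ?P = "PiM I (\<lambda>_. stdn)" and ?Q = "PiM (insert i I) (\<lambda>_. stdn)"
  let ?B = "PiM I (\<lambda>_. borel :: real measure)" and ?C = "PiM (insert i I) (\<lambda>_. borel :: real measure)"
  define R where "R J x y = (\<lambda>j\<in>J. c j * x j + s j * y j)" for J x y
  define R' where "R' J x y = (\<lambda>j\<in>J. s j * x j - c j * y j)" for J x y
  have mR [measurable]: "case_prod (R J) \<in> measurable (PiM J (\<lambda>_. borel) \<Otimes>\<^sub>M PiM J (\<lambda>_. borel)) (PiM J (\<lambda>_. borel))" for J
    unfolding R_def by measurable
  have mR' [measurable]: "case_prod (R' J) \<in> measurable (PiM J (\<lambda>_. borel) \<Otimes>\<^sub>M PiM J (\<lambda>_. borel)) (PiM J (\<lambda>_. borel))" for J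
    unfolding R'_def by measurable
  note I = insert.hyps
  have F[measurable]: "case_prod F \<in> borel_measurable (?C \<Otimes>\<^sub>M ?C)" by (rule insert.prems(1))
  interpret P: prob_space ?P by (rule prob_space_PiM_stdn)
  have [measurable]: "(\<lambda>z. (f z)(i := h z)) \<in> measurable N ?C"
    if "f \<in> measurable N ?B" "h \<in> borel_measurable N" for N :: "'n measure" and f h
    by (rule measurable_fun_upd[where J=I]) (use that in auto)
  have mupd: "(\<lambda>t. x(i := t)) \<in> measurable borel ?C" if "x \<in> space ?P" for x
    using that measurable_component_update[of x I "\<lambda>_. borel" i] I by (simp add: space_PiM)
  have "(\<integral>\<^sup>+ x. \<integral>\<^sup>+ y. F x y \<partial>?Q \<partial>?Q) =
     (\<integral>\<^sup>+ x. \<integral>\<^sup>+ y. \<integral>\<^sup>+ t. \<integral>\<^sup>+ u. F (x(i := t)) (y(i := u)) \<partial>stdn \<partial>stdn \<partial>?P \<partial>?P)"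
    by (rule nn_integral_PiM_stdn_insert_pair[OF I F])
  also have "\<dots> = (\<integral>\<^sup>+ x. \<integral>\<^sup>+ y. \<integral>\<^sup>+ t. \<integral>\<^sup>+ u. F (x(i := c i * t + s i * u)) (y(i := s i * t - c i * u)) \<partial>stdn \<partial>stdn \<partial>?P \<partial>?P)"
  proof (rule nn_integral_cong, rule nn_integral_cong)
    fix x y assume "x \<in> space ?P" "y \<in> space ?P"
    from this[THEN mupd, measurable]
    have "(\<lambda>(t, u). F (x(i := t)) (y(i := u))) \<in> borel_measurable (borel \<Otimes>\<^sub>M borel)"
      by measurable
    then show "(\<integral>\<^sup>+ t. \<integral>\<^sup>+ u. F (x(i := t)) (y(i := u)) \<partial>stdn \<partial>stdn) =
      (\<integral>\<^sup>+ t. \<integral>\<^sup>+ u. F (x(i := c i * t + s i * u)) (y(i := s i * t - c i * u)) \<partial>stdn \<partial>stdn)"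
      by (rule stdn_rotation_invariant) (use insert.prems in auto)
  qed
  \<comment> \<open>The induction hypothesis concerns the integral over \<open>x\<close> and
    \<open>y\<close>, so the pair \<open>(t, u)\<close> is moved outside, held fixed and then moved
    back.\<close>
  also have "\<dots> = (\<integral>\<^sup>+ t. \<integral>\<^sup>+ u. \<integral>\<^sup>+ x. \<integral>\<^sup>+ y. F (x(i := c i * t + s i * u)) (y(i := s i * t - c i * u)) \<partial>?P \<partial>?P \<partial>stdn \<partial>stdn)"
    by (rule nn_integral_swap_pairs[OF P.sigma_finite_measure_axioms stdn.sigma_finite_measure_axioms]) measurable
  also have "\<dots> = (\<integral>\<^sup>+ t. \<integral>\<^sup>+ u. \<integral>\<^sup>+ x. \<integral>\<^sup>+ y. F ((R I x y)(i := c i * t + s i * u)) ((R' I x y)(i := s i * t - c i * u)) \<partial>?P \<partial>?P \<partial>stdn \<partial>stdn)"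
    unfolding R_def R'_def
    by (rule nn_integral_cong, rule nn_integral_cong, rule insert.IH, measurable) (use insert.prems in auto)
  also have "\<dots> = (\<integral>\<^sup>+ x. \<integral>\<^sup>+ y. \<integral>\<^sup>+ t. \<integral>\<^sup>+ u. F ((R I x y)(i := c i * t + s i * u)) ((R' I x y)(i := s i * t - c i * u)) \<partial>stdn \<partial>stdn \<partial>?P \<partial>?P)"
    by (rule nn_integral_swap_pairs[OF P.sigma_finite_measure_axioms stdn.sigma_finite_measure_axioms, symmetric]) measurable
  also have "\<dots> = (\<integral>\<^sup>+ x. \<integral>\<^sup>+ y. \<integral>\<^sup>+ t. \<integral>\<^sup>+ u. F (R (insert i I) (x(i := t)) (y(i := u))) (R' (insert i I) (x(i := t)) (y(i := u))) \<partial>stdn \<partial>stdn \<partial>?P \<partial>?P)"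
  proof -
    have "(R I x y)(i := c i * t + s i * u) = R (insert i I) (x(i := t)) (y(i := u))"
      "(R' I x y)(i := s i * t - c i * u) = R' (insert i I) (x(i := t)) (y(i := u))" for x y t u
      using I by (auto simp: R_def R'_def fun_eq_iff)
    then show ?thesis by simp
  qed
  also have "\<dots> = (\<integral>\<^sup>+ x. \<integral>\<^sup>+ y. F (R (insert i I) x y) (R' (insert i I) x y) \<partial>?Q \<partial>?Q)"
    by (rule nn_integral_PiM_stdn_insert_pair[OF I, symmetric]) measurable
  finally show ?case by (simp only: R_def R'_def)
qed

subsection \<open>Stein's identity and inverse moments\<close>

definition wsq :: "'i set \<Rightarrow> ('i \<Rightarrow> real) \<Rightarrow> ('i \<Rightarrow> real) \<Rightarrow> real" where
  "wsq I s x = (\<Sum>k\<in>I. s k * (x k)\<^sup>2)"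

lemma measurable_wsq [measurable]: "wsq I s \<in> borel_measurable (PiM I (\<lambda>_. borel))"
  unfolding wsq_def by measurable

lemma wsq_nonneg: "(\<And>k. k \<in> I \<Longrightarrow> s k \<ge> 0) \<Longrightarrow> wsq I s x \<ge> 0"
  unfolding wsq_def by (intro sum_nonneg) auto

lemma wsq_component_le:
  assumes "finite I" "\<And>k. k \<in> I \<Longrightarrow> s k \<ge> 0" "j \<in> I"
  shows "s j * (x j)\<^sup>2 \<le> wsq I s x"
  unfolding wsq_def by (rule member_le_sum) (use assms in auto)

text \<open>Domination bounds for the integrands of Stein's identity, with \<open>K\<close> in the
  role of the denominator: the first bound is constant, the second is integrable as soon as
  \<open>1 / K\<close> is.\<close>

lemma weighted_square_div_le:
  fixes s y K :: real
  assumes "s > 0" "K \<ge> s * y\<^sup>2"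
  shows "y\<^sup>2 / K \<le> 1 / s" "s * y\<^sup>2 / K\<^sup>2 \<le> 1 / K"
proof -
  show "y\<^sup>2 / K \<le> 1 / s"
  proof (cases "K > 0")
    case True then show ?thesis using assms by (simp add: field_simps)
  next
    case False
    have "0 \<le> s * y\<^sup>2" using assms by simp
    with False assms have "K = 0" by linarith
    then show ?thesis using assms by simp
  qed
  show "s * y\<^sup>2 / K\<^sup>2 \<le> 1 / K"
  proof (cases "K > 0")
    case True
    have "s * y\<^sup>2 / K\<^sup>2 \<le> K / K\<^sup>2" using assms by (intro divide_right_mono) auto
    also have "\<dots> = 1 / K" using True by (simp add: power2_eq_square)
    finally show ?thesis .
  next
    case False
    have "0 \<le> s * y\<^sup>2" using assms by simp
    with False assms have "K = 0" by linarith
    then show ?thesis by simp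
  qed
qed

text \<open>Gaussian integration by parts for \<open>f y = y / (s * y\<^sup>2 + K)\<close>: the
  integrand is \<open>y * f y - f' y\<close>, and its product with the density is the derivative of
  minus the density times \<open>f\<close>, which vanishes at both ends. \<open>K > 0\<close> keeps
  the integrand bounded.\<close>

lemma stein_stdn:
  assumes s: "s > 0" and K: "K > 0"
  shows "(\<integral>y. y\<^sup>2 / (s * y\<^sup>2 + K) - 1 / (s * y\<^sup>2 + K) + 2 * (s * y\<^sup>2 / (s * y\<^sup>2 + K)\<^sup>2) \<partial>stdn) = 0"
proof -
  let ?D = "\<lambda>y. s * y\<^sup>2 + K"
  define h where "h y = y\<^sup>2 / ?D y - 1 / ?D y + 2 * (s * y\<^sup>2 / (?D y)\<^sup>2)" for y
  have D: "?D y > 0" "?D y \<ge> K" "?D y \<noteq> 0" for y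
    using K s by (auto intro: add_nonneg_pos) (smt (verit) add_nonneg_pos mult_nonneg_nonneg zero_le_power2)+
  have hb: "\<bar>h y\<bar> \<le> 1 / s + 1 / K + 2 * (1 / K)" for y
  proof -
    have "1 / ?D y \<le> 1 / K" using D[of y] K by (simp add: frac_le)
    moreover have "y\<^sup>2 / ?D y \<le> 1 / s" "s * y\<^sup>2 / (?D y)\<^sup>2 \<le> 1 / ?D y"
      using weighted_square_div_le[of s y "?D y"] s K by auto
    moreover have "y\<^sup>2 / ?D y \<ge> 0" "s * y\<^sup>2 / (?D y)\<^sup>2 \<ge> 0" "1 / ?D y \<ge> 0"
      using D[of y] s by (auto intro!: divide_nonneg_nonneg)
    ultimately show ?thesis unfolding h_def by linarith
  qed
  have [measurable]: "h \<in> borel_measurable borel" unfolding h_def by measurable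
  have "integrable stdn h"
    by (rule stdn.integrable_const_bound[where B="1 / s + 1 / K + 2 * (1 / K)"]) (use hb in auto)
  then have int: "integrable lborel (\<lambda>y. std_normal_density y * h y)"
    unfolding stdn_def by (subst (asm) integrable_density) auto
  define F where "F y = - (std_normal_density y * (y / ?D y))" for y
  have der: "(F has_real_derivative (std_normal_density y * h y)) (at y)" for y
  proof -
    have e: "((\<lambda>y. exp (- y\<^sup>2 / 2)) has_real_derivative - y * exp (- y\<^sup>2 / 2)) (at y)"
      by (auto intro!: derivative_eq_intros)
    have n: "(std_normal_density has_real_derivative - y * std_normal_density y) (at y)"
      unfolding std_normal_density_def by (rule DERIV_cong[OF DERIV_cmult[OF e]]) simp
    have d: "(?D has_real_derivative 2 * s * y) (at y)"
      by (auto intro!: derivative_eq_intros)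
    have q: "((\<lambda>y. y / ?D y) has_real_derivative (1 * ?D y - y * (2 * s * y)) / (?D y * ?D y)) (at y)"
      by (rule DERIV_divide[OF DERIV_ident d]) (use D in auto)
    have "(1 * E - y * (2 * s * y)) / (E * E) = 1 / E - 2 * (s * y\<^sup>2 / E\<^sup>2)" if "E \<noteq> 0" for E
      using that by (simp add: field_simps power2_eq_square)
    note q' = this[OF D(3)[of y]]
    have alg: "- (- y * n * (y / A) + (1 / A - 2 * r) * n) = n * (y\<^sup>2 / A - 1 / A + 2 * r)" for A n r
      by (simp add: algebra_simps power2_eq_square)
    have "- (- y * std_normal_density y * (y / ?D y)
        + (1 * ?D y - y * (2 * s * y)) / (?D y * ?D y) * std_normal_density y)
      = std_normal_density y * h y"
      unfolding q' h_def by (rule alg)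
    with DERIV_minus[OF DERIV_mult[OF n q]] show ?thesis
      unfolding F_def by simp
  qed
  have bnd: "\<bar>F y\<bar> \<le> exp (- y\<^sup>2 / 2) * \<bar>y\<bar> * (1 / (sqrt (2 * pi) * K))" for y
  proof -
    have "\<bar>F y\<bar> = exp (- y\<^sup>2 / 2) * \<bar>y\<bar> * (1 / (sqrt (2 * pi) * ?D y))"
      using D[of y] by (simp add: F_def std_normal_density_def abs_mult)
    also have "\<dots> \<le> exp (- y\<^sup>2 / 2) * \<bar>y\<bar> * (1 / (sqrt (2 * pi) * K))"
      using D[of y] K by (intro mult_left_mono divide_left_mono mult_pos_pos) auto
    finally show ?thesis .
  qed
  have lt: "(F \<longlongrightarrow> 0) at_top"
  proof (rule Lim_null_comparison)
    show "\<forall>\<^sub>F y in at_top. norm (F y) \<le> exp (- y\<^sup>2 / 2) * \<bar>y\<bar> * (1 / (sqrt (2 * pi) * K))"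
      using bnd by simp
    have "((\<lambda>y::real. exp (- y\<^sup>2 / 2) * \<bar>y\<bar>) \<longlongrightarrow> 0) at_top" by real_asymp
    then show "((\<lambda>y::real. exp (- y\<^sup>2 / 2) * \<bar>y\<bar> * (1 / (sqrt (2 * pi) * K))) \<longlongrightarrow> 0) at_top"
      by (rule tendsto_mult_left_zero)
  qed
  have lb: "(F \<longlongrightarrow> 0) at_bot"
  proof (rule Lim_null_comparison)
    show "\<forall>\<^sub>F y in at_bot. norm (F y) \<le> exp (- y\<^sup>2 / 2) * \<bar>y\<bar> * (1 / (sqrt (2 * pi) * K))"
      using bnd by simp
    have "((\<lambda>y::real. exp (- y\<^sup>2 / 2) * \<bar>y\<bar>) \<longlongrightarrow> 0) at_bot" by real_asymp
    then show "((\<lambda>y::real. exp (- y\<^sup>2 / 2) * \<bar>y\<bar> * (1 / (sqrt (2 * pi) * K))) \<longlongrightarrow> 0) at_bot"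
      by (rule tendsto_mult_left_zero)
  qed
  have "(LBINT y=-\<infinity>..\<infinity>. std_normal_density y * h y) = 0 - 0"
  proof (rule interval_integral_FTC_integrable)
    show "(F has_vector_derivative std_normal_density y * h y) (at y)" for y
      using der by (simp add: has_real_derivative_iff_has_vector_derivative)
    show "isCont (\<lambda>y. std_normal_density y * h y) y" for y
      unfolding h_def std_normal_density_def by (intro continuous_intros) (use D in auto)
    show "set_integrable lborel (einterval (-\<infinity>) \<infinity>) (\<lambda>y. std_normal_density y * h y)"
      using int by (simp add: set_integrable_def)
  qed (use lt lb in \<open>auto simp: ereal_tendsto_simps\<close>)
  then have "(\<integral>y. std_normal_density y * h y \<partial>lborel) = 0"
    by (simp add: interval_lebesgue_integral_def set_lebesgue_integral_def)
  then have "(\<integral>y. h y \<partial>stdn) = 0"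
    unfolding stdn_def by (subst integral_density) auto
  then show ?thesis unfolding h_def .
qed

context
  fixes I :: "'i set" and s :: "'i \<Rightarrow> real"
  assumes fin: "finite I" and s: "\<And>k. k \<in> I \<Longrightarrow> s k > 0"
begin

interpretation P: prob_space "PiM I (\<lambda>_. stdn)" by (rule prob_space_PiM_stdn)

lemma wsq_bounds:
  assumes "j \<in> I"
  shows "wsq I s x \<ge> 0" "s j * (x j)\<^sup>2 \<le> wsq I s x"
  using wsq_nonneg[of I s x] wsq_component_le[OF fin _ assms, of s x] s by (auto simp: less_imp_le)

text \<open>Coordinate \<open>j\<close> is integrated first, with the others frozen in
  \<open>K = wsq (I - {j}) s x + e\<close>, which turns the claim into the one-dimensional identity.
  The summand \<open>e\<close> makes \<open>K\<close> positive even where all other coordinates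
  vanish and bounds every integrand.\<close>

lemma stein_PiM_regularised:
  assumes j: "j \<in> I" and e: "e > 0"
  shows "(\<integral>x. (x j)\<^sup>2 / (wsq I s x + e) \<partial>PiM I (\<lambda>_. stdn)) =
     (\<integral>x. 1 / (wsq I s x + e) \<partial>PiM I (\<lambda>_. stdn))
      - 2 * (\<integral>x. s j * (x j)\<^sup>2 / (wsq I s x + e)\<^sup>2 \<partial>PiM I (\<lambda>_. stdn))"
    and "integrable (PiM I (\<lambda>_. stdn)) (\<lambda>x. (x j)\<^sup>2 / (wsq I s x + e))"
    and "integrable (PiM I (\<lambda>_. stdn)) (\<lambda>x. 1 / (wsq I s x + e))"
    and "integrable (PiM I (\<lambda>_. stdn)) (\<lambda>x. s j * (x j)\<^sup>2 / (wsq I s x + e)\<^sup>2)"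
proof -
  let ?P = "PiM I (\<lambda>_. stdn)"
  note b = wsq_bounds[OF j]
  have [measurable]: "(\<lambda>x. x j) \<in> borel_measurable (PiM I (\<lambda>_. borel))"
    using j by measurable
  have le: "1 / (wsq I s x + e) \<le> 1 / e" "1 / (wsq I s x + e) \<ge> 0" for x
    using b(1)[of x] e by (auto simp: frac_le)
  have w: "(x j)\<^sup>2 / (wsq I s x + e) \<le> 1 / s j" "s j * (x j)\<^sup>2 / (wsq I s x + e)\<^sup>2 \<le> 1 / (wsq I s x + e)" for x
    using weighted_square_div_le[OF s[OF j], of "x j" "wsq I s x + e"] b(2)[of x] e by auto
  have nn: "(x j)\<^sup>2 / (wsq I s x + e) \<ge> 0" "s j * (x j)\<^sup>2 / (wsq I s x + e)\<^sup>2 \<ge> 0" for x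
    using b(1)[of x] e s[OF j] by (auto intro!: divide_nonneg_nonneg)
  show i1: "integrable ?P (\<lambda>x. (x j)\<^sup>2 / (wsq I s x + e))"
    by (intro P.integrable_const_bound[where B="1 / s j"] AE_I2, unfold real_norm_def, subst abs_of_nonneg, rule nn, rule w) simp
  show i2: "integrable ?P (\<lambda>x. 1 / (wsq I s x + e))"
    by (intro P.integrable_const_bound[where B="1 / e"] AE_I2, unfold real_norm_def, subst abs_of_nonneg, rule le, rule le) simp
  show i3: "integrable ?P (\<lambda>x. s j * (x j)\<^sup>2 / (wsq I s x + e)\<^sup>2)"
    by (intro P.integrable_const_bound[where B="1 / e"] AE_I2, unfold real_norm_def, subst abs_of_nonneg, rule nn, rule order_trans[OF w(2) le(1)]) simp
  define D where "D x = (x j)\<^sup>2 / (wsq I s x + e) - 1 / (wsq I s x + e)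
      + 2 * (s j * (x j)\<^sup>2 / (wsq I s x + e)\<^sup>2)" for x
  have iD: "integrable ?P D"
    unfolding D_def using i1 i2 i3 by (intro Bochner_Integration.integrable_add Bochner_Integration.integrable_diff integrable_mult_right)
  have ins: "insert j (I - {j}) = I" using j by auto
  have "integral\<^sup>L (PiM (insert j (I - {j})) (\<lambda>_. stdn)) D =
     (\<integral>x. (\<integral>y. D (x(j := y)) \<partial>stdn) \<partial>PiM (I - {j}) (\<lambda>_. stdn))"
    by (rule gstd.product_integral_insert) (simp_all add: fin iD ins del: insert_Diff_single)
  also have "\<dots> = (\<integral>x. 0 \<partial>PiM (I - {j}) (\<lambda>_. stdn))"
  proof (rule Bochner_Integration.integral_cong[OF refl])
    fix x
    let ?K = "wsq (I - {j}) s x + e"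
    have K: "?K > 0" using wsq_nonneg[of "I - {j}" s x] s e by (auto simp: less_imp_le add_nonneg_pos)
    have "wsq I s (x(j := y)) + e = s j * y\<^sup>2 + ?K" for y
    proof -
      have "(\<Sum>k\<in>I - {j}. s k * ((x(j := y)) k)\<^sup>2) = (\<Sum>k\<in>I - {j}. s k * (x k)\<^sup>2)"
        by (intro sum.cong) auto
      then show ?thesis unfolding wsq_def sum.remove[OF fin j] by simp
    qed
    then show "(\<integral>y. D (x(j := y)) \<partial>stdn) = 0"
      using stein_stdn[OF s[OF j] K] by (simp only: D_def fun_upd_same)
  qed
  finally have "integral\<^sup>L ?P D = 0" unfolding ins by simp
  moreover have "integral\<^sup>L ?P D = (\<integral>x. (x j)\<^sup>2 / (wsq I s x + e) \<partial>?P) - (\<integral>x. 1 / (wsq I s x + e) \<partial>?P)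
     + 2 * (\<integral>x. s j * (x j)\<^sup>2 / (wsq I s x + e)\<^sup>2 \<partial>?P)"
    unfolding D_def
    using Bochner_Integration.integral_add[OF Bochner_Integration.integrable_diff[OF i1 i2] integrable_mult_right[OF i3, of 2]]
      Bochner_Integration.integral_diff[OF i1 i2] integral_mult_right_zero[of ?P 2 "\<lambda>x. s j * (x j)\<^sup>2 / (wsq I s x + e)\<^sup>2"]
    by argo
  ultimately show "(\<integral>x. (x j)\<^sup>2 / (wsq I s x + e) \<partial>?P) = (\<integral>x. 1 / (wsq I s x + e) \<partial>?P)
      - 2 * (\<integral>x. s j * (x j)\<^sup>2 / (wsq I s x + e)\<^sup>2 \<partial>?P)"
    by linarith
qed

lemma AE_wsq_pos:
  assumes "I \<noteq> {}"
  shows "AE x in PiM I (\<lambda>_. stdn). wsq I s x > 0"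
proof -
  obtain j where j: "j \<in> I" using assms by auto
  have "AE y in lborel. y \<noteq> (0::real)" by (rule AE_lborel_singleton)
  then have "AE y in stdn. y \<noteq> 0"
    unfolding stdn_def by (subst AE_density) auto
  then have "AE x in PiM I (\<lambda>_. stdn). x j \<noteq> 0"
    by (intro AE_PiM_component[where P="\<lambda>y. y \<noteq> 0"] stdn.prob_space_axioms j)
  then show ?thesis
  proof eventually_elim
    case (elim x)
    then have "0 < s j * (x j)\<^sup>2" using s[OF j] by simp
    also have "\<dots> \<le> wsq I s x" using wsq_bounds[OF j] by simp
    finally show ?case .
  qed
qed

text \<open>The regularisation is removed by dominated convergence. The constant
  \<open>1 / s j\<close> dominates the left integrand; the other two are dominated only by
  \<open>1 / wsq I s x\<close>, whose integrability is therefore a hypothesis and is established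
  separately in dimension at least three.\<close>

lemma stein_PiM:
  assumes j: "j \<in> I" and int: "integrable (PiM I (\<lambda>_. stdn)) (\<lambda>x. 1 / wsq I s x)"
  shows "(\<integral>x. (x j)\<^sup>2 / wsq I s x \<partial>PiM I (\<lambda>_. stdn)) =
     (\<integral>x. 1 / wsq I s x \<partial>PiM I (\<lambda>_. stdn))
      - 2 * (\<integral>x. s j * (x j)\<^sup>2 / (wsq I s x)\<^sup>2 \<partial>PiM I (\<lambda>_. stdn))"
    and "integrable (PiM I (\<lambda>_. stdn)) (\<lambda>x. (x j)\<^sup>2 / wsq I s x)"
    and "integrable (PiM I (\<lambda>_. stdn)) (\<lambda>x. s j * (x j)\<^sup>2 / (wsq I s x)\<^sup>2)"
proof -
  let ?P = "PiM I (\<lambda>_. stdn)"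
  define e where "e n = inverse (real (Suc n))" for n
  have e: "e n > 0" for n by (simp add: e_def)
  have e0: "e \<longlonglongrightarrow> 0" unfolding e_def by (rule LIMSEQ_inverse_real_of_nat)
  note b = wsq_bounds[OF j]
  have pos: "AE x in ?P. wsq I s x > 0" by (rule AE_wsq_pos) (use j in auto)
  have [measurable]: "(\<lambda>x. x j) \<in> borel_measurable (PiM I (\<lambda>_. borel))"
    using j by measurable
  have le: "1 / (wsq I s x + e n) \<le> 1 / wsq I s x" "1 / (wsq I s x + e n) \<ge> 0" if "wsq I s x > 0" for x n
    using that e[of n] by (auto simp: frac_le)
  have w: "(x j)\<^sup>2 / (wsq I s x + e n) \<le> 1 / s j" "s j * (x j)\<^sup>2 / (wsq I s x + e n)\<^sup>2 \<le> 1 / (wsq I s x + e n)" for x n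
    using weighted_square_div_le[OF s[OF j], of "x j" "wsq I s x + e n"] b(2)[of x] e[of n] by auto
  have nn: "(x j)\<^sup>2 / (wsq I s x + e n) \<ge> 0" "s j * (x j)\<^sup>2 / (wsq I s x + e n)\<^sup>2 \<ge> 0" for x n
    using b(1)[of x] e[of n] s[OF j] by (auto intro!: divide_nonneg_nonneg)
  have ae: "AE x in ?P. (\<lambda>n. (x j)\<^sup>2 / (wsq I s x + e n)) \<longlonglongrightarrow> (x j)\<^sup>2 / wsq I s x"
       "AE x in ?P. (\<lambda>n. 1 / (wsq I s x + e n)) \<longlonglongrightarrow> 1 / wsq I s x"
       "AE x in ?P. (\<lambda>n. s j * (x j)\<^sup>2 / (wsq I s x + e n)\<^sup>2) \<longlonglongrightarrow> s j * (x j)\<^sup>2 / (wsq I s x)\<^sup>2"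
  proof -
    have l: "(\<lambda>n. wsq I s x + e n) \<longlonglongrightarrow> wsq I s x" for x
      using tendsto_add[OF tendsto_const e0] by simp
    show "AE x in ?P. (\<lambda>n. (x j)\<^sup>2 / (wsq I s x + e n)) \<longlonglongrightarrow> (x j)\<^sup>2 / wsq I s x"
      using pos by eventually_elim (intro tendsto_divide tendsto_const l, simp)
    show "AE x in ?P. (\<lambda>n. 1 / (wsq I s x + e n)) \<longlonglongrightarrow> 1 / wsq I s x"
      using pos by eventually_elim (intro tendsto_divide tendsto_const l, simp)
    show "AE x in ?P. (\<lambda>n. s j * (x j)\<^sup>2 / (wsq I s x + e n)\<^sup>2) \<longlonglongrightarrow> s j * (x j)\<^sup>2 / (wsq I s x)\<^sup>2"
      using pos by eventually_elim (intro tendsto_divide tendsto_const tendsto_power l, simp)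
  qed
  have bd: "AE x in ?P. norm ((x j)\<^sup>2 / (wsq I s x + e n)) \<le> 1 / s j"
       "AE x in ?P. norm (1 / (wsq I s x + e n)) \<le> 1 / wsq I s x"
       "AE x in ?P. norm (s j * (x j)\<^sup>2 / (wsq I s x + e n)\<^sup>2) \<le> 1 / wsq I s x" for n
  proof -
    show "AE x in ?P. norm ((x j)\<^sup>2 / (wsq I s x + e n)) \<le> 1 / s j"
      by (intro AE_I2, unfold real_norm_def, subst abs_of_nonneg, rule nn, rule w)
    show "AE x in ?P. norm (1 / (wsq I s x + e n)) \<le> 1 / wsq I s x"
      using pos by eventually_elim (use le in \<open>simp only: real_norm_def abs_of_nonneg\<close>)
    show "AE x in ?P. norm (s j * (x j)\<^sup>2 / (wsq I s x + e n)\<^sup>2) \<le> 1 / wsq I s x"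
      using pos by eventually_elim (simp only: real_norm_def abs_of_nonneg[OF nn(2)], rule order_trans[OF w(2) le(1)])
  qed
  have c: "integrable ?P (\<lambda>x. 1 / s j)" by simp
  show "integrable ?P (\<lambda>x. (x j)\<^sup>2 / wsq I s x)"
    by (rule integrable_dominated_convergence[OF _ _ c ae(1) bd(1)]) measurable
  show "integrable ?P (\<lambda>x. s j * (x j)\<^sup>2 / (wsq I s x)\<^sup>2)"
    by (rule integrable_dominated_convergence[OF _ _ int ae(3) bd(3)]) measurable
  have l1: "(\<lambda>n. \<integral>x. (x j)\<^sup>2 / (wsq I s x + e n) \<partial>?P) \<longlonglongrightarrow> (\<integral>x. (x j)\<^sup>2 / wsq I s x \<partial>?P)"
    by (rule integral_dominated_convergence[OF _ _ c ae(1) bd(1)]) measurable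
  have l2: "(\<lambda>n. \<integral>x. 1 / (wsq I s x + e n) \<partial>?P) \<longlonglongrightarrow> (\<integral>x. 1 / wsq I s x \<partial>?P)"
    by (rule integral_dominated_convergence[OF _ _ int ae(2) bd(2)]) measurable
  have l3: "(\<lambda>n. \<integral>x. s j * (x j)\<^sup>2 / (wsq I s x + e n)\<^sup>2 \<partial>?P) \<longlonglongrightarrow> (\<integral>x. s j * (x j)\<^sup>2 / (wsq I s x)\<^sup>2 \<partial>?P)"
    by (rule integral_dominated_convergence[OF _ _ int ae(3) bd(3)]) measurable
  have "(\<lambda>n. \<integral>x. (x j)\<^sup>2 / (wsq I s x + e n) \<partial>?P) \<longlonglongrightarrow>
    (\<integral>x. 1 / wsq I s x \<partial>?P) - 2 * (\<integral>x. s j * (x j)\<^sup>2 / (wsq I s x)\<^sup>2 \<partial>?P)"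
    unfolding stein_PiM_regularised(1)[OF j e] by (intro tendsto_intros l2 l3)
  with l1 show "(\<integral>x. (x j)\<^sup>2 / wsq I s x \<partial>?P) =
     (\<integral>x. 1 / wsq I s x \<partial>?P) - 2 * (\<integral>x. s j * (x j)\<^sup>2 / (wsq I s x)\<^sup>2 \<partial>?P)"
    by (rule LIMSEQ_unique)
qed

end

text \<open>With \<open>p = card I\<close>, summing the regularised identities over \<open>j\<close>
  gives \<open>E[R / (R + e)] = p E[1 / (R + e)] - 2 E[R / (R + e)\<^sup>2]\<close>. The left side
  is at most 1 and the last expectation is at most \<open>E[1 / (R + e)]\<close>. What matters is
  that the resulting bound does not depend on \<open>e\<close>.\<close>

lemma integral_inverse_sq_norm_regularised_le:
  fixes I :: "'i set"
  assumes fin: "finite I" and card: "card I \<ge> 3" and e: "e > 0"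
  shows "(\<integral>x. 1 / (wsq I (\<lambda>_. 1) x + e) \<partial>PiM I (\<lambda>_. stdn)) \<le> 1 / (real (card I) - 2)"
proof -
  let ?P = "PiM I (\<lambda>_. stdn)"
  interpret P: prob_space ?P by (rule prob_space_PiM_stdn)
  define R where "R = wsq I (\<lambda>_. 1)"
  have Rx: "R x = (\<Sum>j\<in>I. (x j)\<^sup>2)" for x by (simp add: R_def wsq_def)
  have R0: "R x \<ge> 0" for x unfolding Rx by (intro sum_nonneg) auto
  have st: "(\<integral>x. (x j)\<^sup>2 / (R x + e) \<partial>?P) = (\<integral>x. 1 / (R x + e) \<partial>?P) - 2 * (\<integral>x. (x j)\<^sup>2 / (R x + e)\<^sup>2 \<partial>?P)"
    "integrable ?P (\<lambda>x. (x j)\<^sup>2 / (R x + e))" "integrable ?P (\<lambda>x. 1 / (R x + e))"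
    "integrable ?P (\<lambda>x. (x j)\<^sup>2 / (R x + e)\<^sup>2)" if "j \<in> I" for j
    using stein_PiM_regularised[OF fin _ that e, of "\<lambda>_. 1"] by (auto simp: R_def)
  obtain i where i: "i \<in> I" using card by fastforce
  let ?E = "\<integral>x. 1 / (R x + e) \<partial>?P"
  have "(\<integral>x. R x / (R x + e) \<partial>?P) = (\<Sum>j\<in>I. \<integral>x. (x j)\<^sup>2 / (R x + e) \<partial>?P)"
    unfolding Rx[of "x" for x] sum_divide_distrib
    by (rule Bochner_Integration.integral_sum) (use st(2) in \<open>simp add: Rx\<close>)
  also have "\<dots> = real (card I) * ?E - 2 * (\<Sum>j\<in>I. \<integral>x. (x j)\<^sup>2 / (R x + e)\<^sup>2 \<partial>?P)"
    using st(1) by (simp add: sum_subtractf sum_distrib_left)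
  also have "(\<Sum>j\<in>I. \<integral>x. (x j)\<^sup>2 / (R x + e)\<^sup>2 \<partial>?P) = (\<integral>x. R x / (R x + e)\<^sup>2 \<partial>?P)"
    by (subst Bochner_Integration.integral_sum[symmetric]) (use st(4) in \<open>auto simp: Rx sum_divide_distrib\<close>)
  finally have eq: "(\<integral>x. R x / (R x + e) \<partial>?P) = real (card I) * ?E - 2 * (\<integral>x. R x / (R x + e)\<^sup>2 \<partial>?P)" .
  have int2: "integrable ?P (\<lambda>x. R x / (R x + e)\<^sup>2)"
    using Bochner_Integration.integrable_sum[of I ?P "\<lambda>j x. (x j)\<^sup>2 / (R x + e)\<^sup>2"] st(4)
    by (simp add: Rx sum_divide_distrib)
  have int1: "integrable ?P (\<lambda>x. R x / (R x + e))"
    using Bochner_Integration.integrable_sum[of I ?P "\<lambda>j x. (x j)\<^sup>2 / (R x + e)"] st(2)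
    by (simp add: Rx sum_divide_distrib)
  have "(\<integral>x. R x / (R x + e)\<^sup>2 \<partial>?P) \<le> ?E"
  proof (rule integral_mono[OF int2 st(3)[OF i]])
    fix x
    have "R x / (R x + e)\<^sup>2 \<le> (R x + e) / (R x + e)\<^sup>2" using e by (intro divide_right_mono) auto
    also have "\<dots> = 1 / (R x + e)" by (simp add: power2_eq_square)
    finally show "R x / (R x + e)\<^sup>2 \<le> 1 / (R x + e)" .
  qed
  moreover have "(\<integral>x. R x / (R x + e) \<partial>?P) \<le> (\<integral>x. 1 \<partial>?P)"
  proof (rule integral_mono[OF int1])
    show "R x / (R x + e) \<le> 1" for x using R0[of x] e by simp
  qed simp
  ultimately have "(real (card I) - 2) * ?E \<le> 1"
    using eq by (simp add: P.prob_space algebra_simps)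
  then show ?thesis using card by (simp add: R_def[symmetric] field_simps)
qed

text \<open>Fatou's lemma carries the uniform bound over to \<open>e = 0\<close>; this replaces a
  computation with the chi-squared density.\<close>

lemma integrable_inverse_sq_norm:
  fixes I :: "'i set"
  assumes fin: "finite I" and card: "card I \<ge> 3"
  shows "integrable (PiM I (\<lambda>_. stdn)) (\<lambda>x. 1 / wsq I (\<lambda>_. 1) x)"
proof (rule integrableI_bounded)
  let ?P = "PiM I (\<lambda>_. stdn)"
  define R where "R = wsq I (\<lambda>_. 1)"
  have [measurable]: "R \<in> borel_measurable (PiM I (\<lambda>_. borel))" unfolding R_def by measurable
  define e where "e n = inverse (real (Suc n))" for n
  have e: "e n > 0" for n by (simp add: e_def)
  have e0: "e \<longlonglongrightarrow> 0" unfolding e_def by (rule LIMSEQ_inverse_real_of_nat)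
  have ne: "I \<noteq> {}" using card by auto
  then obtain i where i: "i \<in> I" by auto
  have R0: "R x \<ge> 0" for x unfolding R_def by (intro wsq_nonneg) auto
  have pos: "AE x in ?P. R x > 0"
    unfolding R_def by (rule AE_wsq_pos[OF fin _ ne]) simp
  have "(\<integral>\<^sup>+ x. norm (1 / R x) \<partial>?P) = (\<integral>\<^sup>+ x. liminf (\<lambda>n. ennreal (1 / (R x + e n))) \<partial>?P)"
  proof (rule nn_integral_cong_AE, use pos in eventually_elim)
    fix x assume x: "R x > 0"
    have "(\<lambda>n. 1 / (R x + e n)) \<longlonglongrightarrow> 1 / (R x + 0)"
      using x e0 by (intro tendsto_divide tendsto_add tendsto_const) auto
    then have "(\<lambda>n. ennreal (1 / (R x + e n))) \<longlonglongrightarrow> ennreal (1 / R x)"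
      by (intro tendsto_ennrealI) simp
    then have "liminf (\<lambda>n. ennreal (1 / (R x + e n))) = ennreal (1 / R x)"
      by (rule lim_imp_Liminf[OF sequentially_bot])
    then show "ennreal (norm (1 / R x)) = liminf (\<lambda>n. ennreal (1 / (R x + e n)))"
      using x by simp
  qed
  also have "\<dots> \<le> liminf (\<lambda>n. \<integral>\<^sup>+ x. ennreal (1 / (R x + e n)) \<partial>?P)"
    by (rule nn_integral_liminf) measurable
  also have "\<dots> \<le> liminf (\<lambda>n. ennreal (1 / (real (card I) - 2)))"
  proof (intro Liminf_mono always_eventually allI)
    fix n
    have "(\<integral>\<^sup>+ x. ennreal (1 / (R x + e n)) \<partial>?P) = ennreal (\<integral>x. 1 / (R x + e n) \<partial>?P)"
    proof (rule nn_integral_eq_integral)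
      show "integrable ?P (\<lambda>x. 1 / (R x + e n))"
        unfolding R_def by (rule stein_PiM_regularised(3)[OF fin _ i e]) simp
      show "AE x in ?P. 0 \<le> 1 / (R x + e n)" using R0 e[of n] by (auto intro!: AE_I2 add_nonneg_nonneg)
    qed
    also have "\<dots> \<le> ennreal (1 / (real (card I) - 2))"
      unfolding R_def by (intro ennreal_leI integral_inverse_sq_norm_regularised_le fin card e)
    finally show "(\<integral>\<^sup>+ x. ennreal (1 / (R x + e n)) \<partial>?P) \<le> ennreal (1 / (real (card I) - 2))" .
  qed
  also have "\<dots> < \<infinity>" by (simp add: Liminf_const)
  finally show "(\<integral>\<^sup>+ x. norm (1 / wsq I (\<lambda>_. 1) x) \<partial>?P) < \<infinity>" by (simp add: R_def)
qed measurable

text \<open>Comparison with the unweighted case: the form is at least its smallest weight times the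
  squared norm.\<close>

lemma integrable_inverse_wsq:
  fixes I :: "'i set"
  assumes fin: "finite I" and card: "card I \<ge> 3" and s: "\<And>k. k \<in> I \<Longrightarrow> s k > 0"
  shows "integrable (PiM I (\<lambda>_. stdn)) (\<lambda>x. 1 / wsq I s x)"
proof (rule Bochner_Integration.integrable_bound)
  let ?P = "PiM I (\<lambda>_. stdn)"
  have ne: "I \<noteq> {}" using card by auto
  define m where "m = Min (s ` I)"
  have m: "m > 0" "\<And>k. k \<in> I \<Longrightarrow> m \<le> s k"
    using fin ne s unfolding m_def by (auto simp: Min_gr_iff)
  show "integrable ?P (\<lambda>x. 1 / m * (1 / wsq I (\<lambda>_. 1) x))"
    by (intro integrable_mult_right integrable_inverse_sq_norm fin card)
  show "AE x in ?P. norm (1 / wsq I s x) \<le> norm (1 / m * (1 / wsq I (\<lambda>_. 1) x))"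
    using AE_wsq_pos[OF fin zero_less_one ne]
  proof eventually_elim
    fix x assume x: "wsq I (\<lambda>_. 1) x > 0"
    have "m * wsq I (\<lambda>_. 1) x \<le> wsq I s x"
      unfolding wsq_def sum_distrib_left by (intro sum_mono) (use m in \<open>auto intro: mult_right_mono\<close>)
    moreover have "m * wsq I (\<lambda>_. 1) x > 0" using m x by simp
    ultimately have "1 / wsq I s x \<le> 1 / (m * wsq I (\<lambda>_. 1) x)" "wsq I s x > 0"
      by (auto simp: frac_le)
    then show "norm (1 / wsq I s x) \<le> norm (1 / m * (1 / wsq I (\<lambda>_. 1) x))"
      using m x by simp
  qed
qed measurable

text \<open>At \<open>e = 0\<close> the two estimates of the regularised argument become equalities,
  \<open>R / R = 1\<close> almost everywhere and \<open>R / R\<^sup>2 = 1 / R\<close>, so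
  \<open>1 = (card I - 2) E[1 / R]\<close>. For the second claim, the expectations of
  \<open>(x j)\<^sup>2 / (R x)\<^sup>2\<close> agree by symmetry and sum to
  \<open>E[1 / R]\<close>.\<close>

lemma integral_inverse_sq_norm:
  fixes I :: "'i set"
  assumes fin: "finite I" and card: "card I \<ge> 3"
  defines "P \<equiv> PiM I (\<lambda>_. stdn)" and "R \<equiv> wsq I (\<lambda>_. 1)"
  shows "(\<integral>x. 1 / R x \<partial>P) = 1 / (real (card I) - 2)"
    and "\<And>j. j \<in> I \<Longrightarrow> (\<integral>x. (x j)\<^sup>2 / (R x)\<^sup>2 \<partial>P) = (\<integral>x. 1 / R x \<partial>P) / real (card I)"
proof -
  interpret P: prob_space P unfolding P_def by (rule prob_space_PiM_stdn)
  have ne: "I \<noteq> {}" using card by auto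
  have [measurable]: "R \<in> borel_measurable (PiM I (\<lambda>_. borel))" unfolding R_def by measurable
  have [measurable_cong]: "sets P = sets (PiM I (\<lambda>_. borel))" unfolding P_def by (rule sets_PiM_stdn)
  have Rx: "R x = (\<Sum>j\<in>I. (x j)\<^sup>2)" for x by (simp add: R_def wsq_def)
  have int: "integrable P (\<lambda>x. 1 / R x)"
    unfolding P_def R_def by (rule integrable_inverse_sq_norm[OF fin card])
  have pos: "AE x in P. R x > 0"
    unfolding P_def R_def by (rule AE_wsq_pos[OF fin zero_less_one ne])
  have st: "(\<integral>x. (x j)\<^sup>2 / R x \<partial>P) = (\<integral>x. 1 / R x \<partial>P) - 2 * (\<integral>x. (x j)\<^sup>2 / (R x)\<^sup>2 \<partial>P)"
    "integrable P (\<lambda>x. (x j)\<^sup>2 / R x)" "integrable P (\<lambda>x. (x j)\<^sup>2 / (R x)\<^sup>2)" if "j \<in> I" for j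
    using stein_PiM[OF fin zero_less_one that int[unfolded P_def R_def]] by (simp_all add: R_def P_def)
  have s2: "(\<Sum>j\<in>I. \<integral>x. (x j)\<^sup>2 / (R x)\<^sup>2 \<partial>P) = (\<integral>x. 1 / R x \<partial>P)"
  proof -
    have "(\<Sum>j\<in>I. \<integral>x. (x j)\<^sup>2 / (R x)\<^sup>2 \<partial>P) = (\<integral>x. (\<Sum>j\<in>I. (x j)\<^sup>2 / (R x)\<^sup>2) \<partial>P)"
      by (rule Bochner_Integration.integral_sum[symmetric]) (rule st(3))
    also have "\<dots> = (\<integral>x. 1 / R x \<partial>P)"
    proof (intro Bochner_Integration.integral_cong refl)
      fix x
      have "(\<Sum>j\<in>I. (x j)\<^sup>2 / (R x)\<^sup>2) = R x / (R x)\<^sup>2"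
        by (simp only: sum_divide_distrib[symmetric] Rx[symmetric])
      then show "(\<Sum>j\<in>I. (x j)\<^sup>2 / (R x)\<^sup>2) = 1 / R x" by (simp add: power2_eq_square)
    qed
    finally show ?thesis .
  qed
  have "(\<Sum>j\<in>I. \<integral>x. (x j)\<^sup>2 / R x \<partial>P) = (\<integral>x. (\<Sum>j\<in>I. (x j)\<^sup>2 / R x) \<partial>P)"
    by (rule Bochner_Integration.integral_sum[symmetric]) (rule st(2))
  also have "\<dots> = (\<integral>x. 1 \<partial>P)"
  proof (rule integral_cong_AE)
    show "AE x in P. (\<Sum>j\<in>I. (x j)\<^sup>2 / R x) = 1"
      using pos by eventually_elim (simp add: sum_divide_distrib[symmetric] Rx[symmetric])
  qed measurable
  finally have s1: "(\<Sum>j\<in>I. \<integral>x. (x j)\<^sup>2 / R x \<partial>P) = 1" by (simp add: P.prob_space)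
  have "1 = real (card I) * (\<integral>x. 1 / R x \<partial>P) - 2 * (\<integral>x. 1 / R x \<partial>P)"
    using s1 st(1) s2 by (simp add: sum_subtractf sum_distrib_left[symmetric])
  then have "(real (card I) - 2) * (\<integral>x. 1 / R x \<partial>P) = 1" by (simp add: algebra_simps)
  then show "(\<integral>x. 1 / R x \<partial>P) = 1 / (real (card I) - 2)" using card by (simp add: field_simps)
  fix j assume j: "j \<in> I"
  \<comment> \<open>Transposing the coordinates \<open>i\<close> and \<open>j\<close> preserves both
    the product measure and the norm.\<close>
  have sym: "(\<integral>x. (x i)\<^sup>2 / (R x)\<^sup>2 \<partial>P) = (\<integral>x. (x j)\<^sup>2 / (R x)\<^sup>2 \<partial>P)" if i: "i \<in> I" for i
  proof -
    define f where "f = Transposition.transpose i j"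
    have bij: "bij_betw f I I" unfolding f_def using i j
      by (auto intro!: bij_betw_byWitness[where f'="Transposition.transpose i j"] simp: Transposition.transpose_def)
    have fI: "f k \<in> I" if "k \<in> I" for k using bij that by (auto simp: bij_betw_def)
    have mf: "(\<lambda>x. \<lambda>n\<in>I. x (f n)) \<in> measurable P P"
      unfolding P_def by (intro measurable_restrict measurable_component_singleton fI)
    have "distr P P (\<lambda>x. \<lambda>n\<in>I. x (f n)) = P"
      unfolding P_def using distr_PiM_reindex[of I "\<lambda>_. stdn" f I] bij stdn.prob_space_axioms
      by (auto simp: bij_betw_def)
    then have "(\<integral>x. (x j)\<^sup>2 / (R x)\<^sup>2 \<partial>P) = (\<integral>x. (x j)\<^sup>2 / (R x)\<^sup>2 \<partial>distr P P (\<lambda>x. \<lambda>n\<in>I. x (f n)))"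
      by simp
    also have "\<dots> = (\<integral>x. ((\<lambda>n\<in>I. x (f n)) j)\<^sup>2 / (R (\<lambda>n\<in>I. x (f n)))\<^sup>2 \<partial>P)"
      using j by (intro integral_distr mf) measurable
    finally have eq: "(\<integral>x. (x j)\<^sup>2 / (R x)\<^sup>2 \<partial>P) = (\<integral>x. ((\<lambda>n\<in>I. x (f n)) j)\<^sup>2 / (R (\<lambda>n\<in>I. x (f n)))\<^sup>2 \<partial>P)" .
    have "R (\<lambda>n\<in>I. x (f n)) = R x" for x
      unfolding Rx using sum.reindex_bij_betw[OF bij, of "\<lambda>k. (x k)\<^sup>2"] by (simp cong: sum.cong)
    then show ?thesis using j eq by (simp add: f_def)
  qed
  have "(\<integral>x. 1 / R x \<partial>P) = real (card I) * (\<integral>x. (x j)\<^sup>2 / (R x)\<^sup>2 \<partial>P)"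
    unfolding s2[symmetric] using sym by simp
  then show "(\<integral>x. (x j)\<^sup>2 / (R x)\<^sup>2 \<partial>P) = (\<integral>x. 1 / R x \<partial>P) / real (card I)"
    using ne fin by simp
qed

text \<open>Integrates the tangent inequality \<open>1 / S \<ge> 2 / y - S / y\<^sup>2\<close> at \<open>y = t R\<close>, where \<open>R\<close> is the
  squared norm and \<open>t\<close> the mean weight; by exchangeability \<open>E[S / R\<^sup>2] = t E[1 / R]\<close>.\<close>

lemma integral_inverse_wsq_ge:
  fixes I :: "'i set"
  assumes fin: "finite I" and card: "card I \<ge> 3" and s: "\<And>k. k \<in> I \<Longrightarrow> s k > 0"
  shows "(\<integral>x. 1 / wsq I s x \<partial>PiM I (\<lambda>_. stdn)) \<ge> real (card I) / ((real (card I) - 2) * (\<Sum>k\<in>I. s k))"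
proof -
  let ?P = "PiM I (\<lambda>_. stdn)" and ?p = "real (card I)" and ?T = "\<Sum>k\<in>I. s k"
  define R where "R = wsq I (\<lambda>_. 1)"
  have ne: "I \<noteq> {}" using card by auto
  have T: "?T > 0" by (rule sum_pos) (use fin ne s in auto)
  define t where "t = ?T / ?p"
  have p: "?p > 2" using card by simp
  have t: "t > 0" using T p by (simp add: t_def)
  have int: "integrable ?P (\<lambda>x. 1 / R x)"
    unfolding R_def by (rule integrable_inverse_sq_norm[OF fin card])
  have Rj: "integrable ?P (\<lambda>x. (x j)\<^sup>2 / (R x)\<^sup>2)" if "j \<in> I" for j
    using stein_PiM(3)[OF fin zero_less_one that int[unfolded R_def]] by (simp add: R_def)
  have eq: "wsq I s x / (R x)\<^sup>2 = (\<Sum>j\<in>I. s j * ((x j)\<^sup>2 / (R x)\<^sup>2))" for x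
    by (simp add: wsq_def sum_divide_distrib)
  have intS: "integrable ?P (\<lambda>x. wsq I s x / (R x)\<^sup>2)"
    unfolding eq by (intro Bochner_Integration.integrable_sum integrable_mult_right Rj)
  let ?E = "\<integral>x. 1 / R x \<partial>?P"
  have ES: "(\<integral>x. wsq I s x / (R x)\<^sup>2 \<partial>?P) = t * ?E"
  proof -
    have "(\<integral>x. wsq I s x / (R x)\<^sup>2 \<partial>?P) = (\<Sum>j\<in>I. s j * (\<integral>x. (x j)\<^sup>2 / (R x)\<^sup>2 \<partial>?P))"
      unfolding eq by (subst Bochner_Integration.integral_sum) (auto intro!: integrable_mult_right Rj simp del: times_divide_eq_right)
    also have "\<dots> = (\<Sum>j\<in>I. s j * (?E / ?p))"
      by (intro sum.cong refl) (simp add: R_def integral_inverse_sq_norm(2)[OF fin card])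
    finally show ?thesis by (simp add: t_def sum_distrib_right[symmetric] sum_divide_distrib[symmetric])
  qed
  have "?E / t = 2 / t * ?E - 1 / t\<^sup>2 * (t * ?E)"
    using t by (simp add: field_simps power2_eq_square)
  also have "\<dots> = (\<integral>x. 2 / t * (1 / R x) - 1 / t\<^sup>2 * (wsq I s x / (R x)\<^sup>2) \<partial>?P)"
    using Bochner_Integration.integral_diff[OF integrable_mult_right[OF int, of "2 / t"] integrable_mult_right[OF intS, of "1 / t\<^sup>2"]]
      integral_mult_right_zero[of ?P "2 / t" "\<lambda>x. 1 / R x"] integral_mult_right_zero[of ?P "1 / t\<^sup>2" "\<lambda>x. wsq I s x / (R x)\<^sup>2"] ES
    by simp
  also have "\<dots> \<le> (\<integral>x. 1 / wsq I s x \<partial>?P)"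
  proof (rule integral_mono_AE)
    show "integrable ?P (\<lambda>x. 2 / t * (1 / R x) - 1 / t\<^sup>2 * (wsq I s x / (R x)\<^sup>2))"
      by (intro Bochner_Integration.integrable_diff integrable_mult_right int intS)
    show "integrable ?P (\<lambda>x. 1 / wsq I s x)" by (rule integrable_inverse_wsq[OF fin card s])
    show "AE x in ?P. 2 / t * (1 / R x) - 1 / t\<^sup>2 * (wsq I s x / (R x)\<^sup>2) \<le> 1 / wsq I s x"
      using AE_wsq_pos[OF fin zero_less_one ne] AE_wsq_pos[of I s, OF fin s ne, simplified]
    proof eventually_elim
      fix x assume "wsq I (\<lambda>_. 1) x > 0" and S: "wsq I s x > 0"
      then have R: "R x > 0" by (simp add: R_def)
      define y where "y = t * R x"
      have y: "y > 0" using t R by (simp add: y_def)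
      have "0 \<le> (y - wsq I s x)\<^sup>2 / (y\<^sup>2 * wsq I s x)" using S by simp
      also have "\<dots> = 1 / wsq I s x - (2 / y - wsq I s x / y\<^sup>2)"
        using y S by (simp add: field_simps power2_eq_square)
      finally show "2 / t * (1 / R x) - 1 / t\<^sup>2 * (wsq I s x / (R x)\<^sup>2) \<le> 1 / wsq I s x"
        by (simp add: y_def power_mult_distrib)
    qed
  qed
  finally have "?E / t \<le> (\<integral>x. 1 / wsq I s x \<partial>?P)" .
  moreover have "?E = 1 / (?p - 2)" unfolding R_def by (rule integral_inverse_sq_norm(1)[OF fin card])
  ultimately show ?thesis by (simp add: t_def)
qed

subsection \<open>The Bayes risk\<close>

lemma stdn_moments:
  "integrable stdn (\<lambda>y. y)" "(\<integral>y. y \<partial>stdn) = 0"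
  "integrable stdn (\<lambda>y. y\<^sup>2)" "(\<integral>y. y\<^sup>2 \<partial>stdn) = 1"
proof -
  show "integrable stdn (\<lambda>y. y)"
    unfolding stdn_def by (subst integrable_density) (use integrable_std_normal_moment[of 1] in auto)
  show "integrable stdn (\<lambda>y. y\<^sup>2)"
    unfolding stdn_def by (subst integrable_density) (use integrable_std_normal_moment[of 2] in auto)
  show "(\<integral>y. y \<partial>stdn) = 0"
    unfolding stdn_def by (subst integral_density) (use integral_std_normal_moment_odd[of 0] in auto)
  show "(\<integral>y. y\<^sup>2 \<partial>stdn) = 1"
    unfolding stdn_def by (subst integral_density) (use integral_std_normal_moment_even[of 1] in \<open>auto simp: fact_numeral\<close>)
qed

lemma PiM_stdn_moments:
  assumes j: "j \<in> I"
  shows "integrable (PiM I (\<lambda>_. stdn)) (\<lambda>x. x j)" "(\<integral>x. x j \<partial>PiM I (\<lambda>_. stdn)) = 0"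
    "integrable (PiM I (\<lambda>_. stdn)) (\<lambda>x. (x j)\<^sup>2)" "(\<integral>x. (x j)\<^sup>2 \<partial>PiM I (\<lambda>_. stdn)) = 1"
proof -
  let ?P = "PiM I (\<lambda>_. stdn)"
  have d: "distr ?P stdn (\<lambda>x. x j) = stdn"
    by (rule distr_PiM_component) (use j stdn.prob_space_axioms in auto)
  have m: "(\<lambda>x. x j) \<in> measurable ?P stdn" using j by measurable
  show "integrable ?P (\<lambda>x. x j)"
    using integrable_distr_eq[OF m, of "\<lambda>y. y"] stdn_moments(1) unfolding d by simp
  show "(\<integral>x. x j \<partial>?P) = 0"
    using integral_distr[OF m, of "\<lambda>y. y"] stdn_moments(2) unfolding d by simp
  show "integrable ?P (\<lambda>x. (x j)\<^sup>2)"
    using integrable_distr_eq[OF m, of "\<lambda>y. y\<^sup>2"] stdn_moments(3) unfolding d by simp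
  show "(\<integral>x. (x j)\<^sup>2 \<partial>?P) = 1"
    using integral_distr[OF m, of "\<lambda>y. y\<^sup>2"] stdn_moments(4) unfolding d by simp
qed

text \<open>Integrates out the posterior noise \<open>h\<close>: \<open>\<alpha>\<close> will depend
  on the observation only, so the cross terms have mean 0.\<close>

lemma nn_integral_PiM_stdn_sum_sq:
  assumes "finite I"
  shows "(\<integral>\<^sup>+ h. ennreal (\<Sum>j\<in>I. (\<alpha> j - \<beta> j * h j)\<^sup>2) \<partial>PiM I (\<lambda>_. stdn)) =
    ennreal (\<Sum>j\<in>I. (\<alpha> j)\<^sup>2 + (\<beta> j)\<^sup>2)"
proof -
  let ?P = "PiM I (\<lambda>_. stdn)"
  interpret P: prob_space ?P by (rule prob_space_PiM_stdn)
  have e: "(\<alpha> j - \<beta> j * h j)\<^sup>2 = (\<alpha> j)\<^sup>2 - 2 * \<alpha> j * \<beta> j * h j + (\<beta> j)\<^sup>2 * (h j)\<^sup>2" for j and h :: "'a \<Rightarrow> real"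
    by (simp add: power2_eq_square algebra_simps)
  have i: "integrable ?P (\<lambda>h. (\<alpha> j - \<beta> j * h j)\<^sup>2)" if "j \<in> I" for j
    unfolding e by (intro Bochner_Integration.integrable_add Bochner_Integration.integrable_diff
      integrable_mult_right PiM_stdn_moments that) simp
  have v: "(\<integral>h. (\<alpha> j - \<beta> j * h j)\<^sup>2 \<partial>?P) = (\<alpha> j)\<^sup>2 + (\<beta> j)\<^sup>2" if "j \<in> I" for j
    unfolding e using PiM_stdn_moments[OF that] by (simp add: P.prob_space)
  have "(\<integral>\<^sup>+ h. ennreal (\<Sum>j\<in>I. (\<alpha> j - \<beta> j * h j)\<^sup>2) \<partial>?P) = ennreal (\<integral>h. (\<Sum>j\<in>I. (\<alpha> j - \<beta> j * h j)\<^sup>2) \<partial>?P)"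
    by (rule nn_integral_eq_integral) (auto intro!: Bochner_Integration.integrable_sum i sum_nonneg)
  also have "(\<integral>h. (\<Sum>j\<in>I. (\<alpha> j - \<beta> j * h j)\<^sup>2) \<partial>?P) = (\<Sum>j\<in>I. (\<alpha> j)\<^sup>2 + (\<beta> j)\<^sup>2)"
    using i v by (simp add: Bochner_Integration.integral_sum)
  finally show ?thesis .
qed

text \<open>Points of a product space are \<open>undefined\<close> off the index set; this allows
  restricted and unrestricted vectors to be exchanged.\<close>

lemma delta_A_cong: "(\<And>k. k \<in> {1..p} \<Longrightarrow> x k = y k) \<Longrightarrow> j \<in> {1..p} \<Longrightarrow> delta_A p d a x j = delta_A p d a y j"
proof -
  assume *: "\<And>k. k \<in> {1..p} \<Longrightarrow> x k = y k" "j \<in> {1..p}"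
  have "(\<Sum>k\<in>{1..p}. (a k * x k)\<^sup>2) = (\<Sum>k\<in>{1..p}. (a k * y k)\<^sup>2)"
    by (intro sum.cong refl) (use * in auto)
  with * show "delta_A p d a x j = delta_A p d a y j" unfolding delta_A_def by simp
qed

lemma measurable_delta_A [measurable]:
  "j \<in> {1..p} \<Longrightarrow> (\<lambda>x. delta_A p d a x j) \<in> borel_measurable (PiM {1..p} (\<lambda>_. borel))"
  unfolding delta_A_def by measurable

lemma bayes_risk_eq_stdn:
  assumes d: "\<And>j. j \<in> {1..p} \<Longrightarrow> d j > 0" and \<gamma>: "\<And>j. j \<in> {1..p} \<Longrightarrow> \<gamma> j \<ge> 0"
  shows "bayes_risk p d \<gamma> (delta_A p d a) =
    (\<integral>\<^sup>+ g. \<integral>\<^sup>+ h. ennreal (\<Sum>j\<in>{1..p}. (delta_A p d a (\<lambda>j. sqrt (\<gamma> j) * g j + sqrt (d j) * h j) j - sqrt (\<gamma> j) * g j)\<^sup>2)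
       \<partial>PiM {1..p} (\<lambda>_. stdn) \<partial>PiM {1..p} (\<lambda>_. stdn))"
proof -
  let ?I = "{1..p}" let ?P = "PiM ?I (\<lambda>_. stdn)" and ?L = "PiM ?I (\<lambda>_. lborel :: real measure)"
  let ?\<delta> = "delta_A p d a"
  interpret P: prob_space ?P by (rule prob_space_PiM_stdn)
  have [measurable_cong]: "sets ?L = sets (PiM ?I (\<lambda>_. borel))" by (intro sets_PiM_cong) auto
  have in1: "(\<integral>\<^sup>+ x. ennreal (\<Sum>j\<in>?I. (?\<delta> x j - \<theta> j)\<^sup>2) \<partial>gauss_diag p \<theta> d) =
      (\<integral>\<^sup>+ h. ennreal (\<Sum>j\<in>?I. (?\<delta> (\<lambda>j\<in>?I. \<theta> j + sqrt (d j) * h j) j - \<theta> j)\<^sup>2) \<partial>?P)" for \<theta>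
  proof -
    have "gauss_diag p \<theta> d = distr ?P ?L (\<lambda>z. \<lambda>j\<in>?I. \<theta> j + sqrt (d j) * z j)"
      by (rule gauss_diag_eq_distr_stdn) (use d in \<open>auto simp: less_imp_le\<close>)
    then show ?thesis by (simp only:) (rule nn_integral_distr; measurable)
  qed
  have out: "gauss_diag p (\<lambda>_. 0) \<gamma> = distr ?P ?L (\<lambda>z. \<lambda>j\<in>?I. 0 + sqrt (\<gamma> j) * z j)"
    by (rule gauss_diag_eq_distr_stdn) (rule \<gamma>)
  have "bayes_risk p d \<gamma> ?\<delta> = (\<integral>\<^sup>+ \<theta>. \<integral>\<^sup>+ h. ennreal (\<Sum>j\<in>?I. (?\<delta> (\<lambda>j\<in>?I. \<theta> j + sqrt (d j) * h j) j - \<theta> j)\<^sup>2) \<partial>?P \<partial>distr ?P ?L (\<lambda>z. \<lambda>j\<in>?I. 0 + sqrt (\<gamma> j) * z j))"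
    unfolding bayes_risk_def in1 out ..
  also have "\<dots> = (\<integral>\<^sup>+ g. \<integral>\<^sup>+ h. ennreal (\<Sum>j\<in>?I. (?\<delta> (\<lambda>j\<in>?I. (\<lambda>j\<in>?I. 0 + sqrt (\<gamma> j) * g j) j + sqrt (d j) * h j) j
       - (\<lambda>j\<in>?I. 0 + sqrt (\<gamma> j) * g j) j)\<^sup>2) \<partial>?P \<partial>?P)"
    by (rule nn_integral_distr) measurable
  also have "\<dots> = (\<integral>\<^sup>+ g. \<integral>\<^sup>+ h. ennreal (\<Sum>j\<in>{1..p}. (delta_A p d a (\<lambda>j. sqrt (\<gamma> j) * g j + sqrt (d j) * h j) j - sqrt (\<gamma> j) * g j)\<^sup>2) \<partial>?P \<partial>?P)"
  proof -
    have "?\<delta> (\<lambda>j\<in>?I. (\<lambda>j\<in>?I. 0 + sqrt (\<gamma> j) * g j) j + sqrt (d j) * h j) j =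
       ?\<delta> (\<lambda>j. sqrt (\<gamma> j) * g j + sqrt (d j) * h j) j" if "j \<in> ?I" for g h j
      by (rule delta_A_cong) (use that in auto)
    then show ?thesis by (intro nn_integral_cong arg_cong[where f=ennreal] sum.cong refl) auto
  qed
  finally show ?thesis .
qed

text \<open>After the rotation the observation is \<open>sqrt (v j) * g j\<close>, and
  \<open>\<theta> j\<close> is the posterior mean \<open>\<gamma> j / sqrt (v j) * g j\<close> plus
  noise in \<open>h j\<close>. The first summand is the squared distance of the estimator from the
  posterior mean, the second is the posterior variance.\<close>

lemma bayes_risk_eq_rotated:
  assumes d: "\<And>j. j \<in> {1..p} \<Longrightarrow> d j > 0" and \<gamma>: "\<And>j. j \<in> {1..p} \<Longrightarrow> \<gamma> j \<ge> 0"
  defines "v \<equiv> (\<lambda>j. d j + \<gamma> j)"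
  shows "bayes_risk p d \<gamma> (delta_A p d a) =
    (\<integral>\<^sup>+ g. ennreal (\<Sum>j\<in>{1..p}.
       (g j * (d j / sqrt (v j) - cstar p d a * a j * sqrt (v j) / wsq {1..p} (\<lambda>k. (a k)\<^sup>2 * v k) g))\<^sup>2
       + (sqrt (\<gamma> j) * sqrt (d j) / sqrt (v j))\<^sup>2) \<partial>PiM {1..p} (\<lambda>_. stdn))"
proof -
  let ?I = "{1..p}" let ?P = "PiM ?I (\<lambda>_. stdn)" let ?\<delta> = "delta_A p d a"
  let ?S = "wsq ?I (\<lambda>k. (a k)\<^sup>2 * v k)"
  \<comment> \<open>With these coefficients
    \<open>sqrt (\<gamma> j) * s j = sqrt (d j) * c j\<close>, which makes \<open>h\<close> drop out
    of the observation.\<close>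
  define c where "c j = sqrt (\<gamma> j) / sqrt (v j)" for j
  define s where "s j = sqrt (d j) / sqrt (v j)" for j
  have v: "v j > 0" if "j \<in> ?I" for j using d[OF that] \<gamma>[OF that] by (simp add: v_def)
  have cs: "(c j)\<^sup>2 + (s j)\<^sup>2 = 1" "s j > 0" if "j \<in> ?I" for j
    using d[OF that] \<gamma>[OF that] v[OF that]
    by (auto simp: c_def s_def power_divide add_divide_distrib[symmetric]) (simp add: v_def)
  define F where "F g h = ennreal (\<Sum>j\<in>?I. (?\<delta> (\<lambda>j\<in>?I. sqrt (\<gamma> j) * g j + sqrt (d j) * h j) j - sqrt (\<gamma> j) * g j)\<^sup>2)" for g h
  have mF: "case_prod F \<in> borel_measurable (PiM ?I (\<lambda>_. borel) \<Otimes>\<^sub>M PiM ?I (\<lambda>_. borel))"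
    unfolding F_def by measurable
  have "bayes_risk p d \<gamma> ?\<delta> = (\<integral>\<^sup>+ g. \<integral>\<^sup>+ h. F g h \<partial>?P \<partial>?P)"
    unfolding F_def
    by (subst bayes_risk_eq_stdn, use d \<gamma> in auto)
       (intro nn_integral_cong arg_cong[where f=ennreal] sum.cong refl arg_cong[where f="\<lambda>x. x\<^sup>2"]
        arg_cong2[where f="(-)"] delta_A_cong; simp)
  also have "\<dots> = (\<integral>\<^sup>+ g. \<integral>\<^sup>+ h. F (\<lambda>j\<in>?I. c j * g j + s j * h j) (\<lambda>j\<in>?I. s j * g j - c j * h j) \<partial>?P \<partial>?P)"
    by (rule stdn_PiM_rotation_invariant[OF _ mF]) (use cs in auto)
  also have "\<dots> = (\<integral>\<^sup>+ g. \<integral>\<^sup>+ h. ennreal (\<Sum>j\<in>?I. (g j * (d j / sqrt (v j) - cstar p d a * a j * sqrt (v j) / ?S g)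
       - sqrt (\<gamma> j) * sqrt (d j) / sqrt (v j) * h j)\<^sup>2) \<partial>?P \<partial>?P)"
  proof (intro nn_integral_cong)
    fix g h :: "nat \<Rightarrow> real"
    have x: "sqrt (\<gamma> j) * (c j * g j + s j * h j) + sqrt (d j) * (s j * g j - c j * h j) = sqrt (v j) * g j"
      if "j \<in> ?I" for j
    proof -
      have "sqrt (\<gamma> j) * (c j * g j + s j * h j) + sqrt (d j) * (s j * g j - c j * h j) =
        (sqrt (\<gamma> j) * sqrt (\<gamma> j) + sqrt (d j) * sqrt (d j)) / sqrt (v j) * g j"
        by (simp add: c_def s_def algebra_simps add_divide_distrib)
      also have "sqrt (\<gamma> j) * sqrt (\<gamma> j) + sqrt (d j) * sqrt (d j) = v j"
        using d[OF that] \<gamma>[OF that] by (simp add: v_def)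
      finally show ?thesis using v[OF that] by (simp add: real_div_sqrt)
    qed
    have th: "sqrt (\<gamma> j) * (c j * g j + s j * h j) = \<gamma> j / sqrt (v j) * g j + sqrt (\<gamma> j) * sqrt (d j) / sqrt (v j) * h j"
      if "j \<in> ?I" for j
      using \<gamma>[OF that] by (simp add: c_def s_def algebra_simps)
    have S: "(\<Sum>k\<in>?I. (a k * (sqrt (v k) * g k))\<^sup>2) = ?S g"
      unfolding wsq_def by (intro sum.cong refl) (use v in \<open>auto simp: power_mult_distrib less_imp_le\<close>)
    have t: "?\<delta> (\<lambda>j\<in>?I. sqrt (\<gamma> j) * (\<lambda>j\<in>?I. c j * g j + s j * h j) j + sqrt (d j) * (\<lambda>j\<in>?I. s j * g j - c j * h j) j) j
        - sqrt (\<gamma> j) * (\<lambda>j\<in>?I. c j * g j + s j * h j) j =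
       g j * (d j / sqrt (v j) - cstar p d a * a j * sqrt (v j) / ?S g) - sqrt (\<gamma> j) * sqrt (d j) / sqrt (v j) * h j"
      if j: "j \<in> ?I" for j
    proof -
      have "?\<delta> (\<lambda>j\<in>?I. sqrt (\<gamma> j) * (\<lambda>j\<in>?I. c j * g j + s j * h j) j + sqrt (d j) * (\<lambda>j\<in>?I. s j * g j - c j * h j) j) j =
        ?\<delta> (\<lambda>j. sqrt (v j) * g j) j"
        by (rule delta_A_cong[OF _ j]) (use x in auto)
      also have "\<dots> = sqrt (v j) * g j - cstar p d a / ?S g * (a j * (sqrt (v j) * g j))"
        unfolding delta_A_def S ..
      finally have A: "?\<delta> (\<lambda>j\<in>?I. sqrt (\<gamma> j) * (\<lambda>j\<in>?I. c j * g j + s j * h j) j + sqrt (d j) * (\<lambda>j\<in>?I. s j * g j - c j * h j) j) j =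
        sqrt (v j) * g j - cstar p d a / ?S g * (a j * (sqrt (v j) * g j))" .
      have B: "(\<lambda>j\<in>?I. c j * g j + s j * h j) j = c j * g j + s j * h j" using j by (rule restrict_apply')
      have "sqrt (v j) = v j / sqrt (v j)" using v[OF j] by (simp add: real_div_sqrt)
      then have V: "sqrt (v j) = d j / sqrt (v j) + \<gamma> j / sqrt (v j)"
        by (simp add: v_def add_divide_distrib)
      \<comment> \<open>\<open>W = D + E\<close> splits \<open>sqrt (v j)\<close> into its
        \<open>d\<close> part and its \<open>\<gamma>\<close> part; the latter is the posterior mean
        and cancels.\<close>
      have "W * G - k / S * (A * (W * G)) - (E * G + b) = G * (D - k * A * W / S) - b" if "W = D + E" for W G k S A D E b :: real
      proof -
        have "W * G = D * G + E * G" using that by (simp add: distrib_right)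
        moreover have "G * (D - k * A * W / S) = D * G - k / S * (A * (W * G))" by (simp add: algebra_simps)
        ultimately show ?thesis by linarith
      qed
      from this[OF V] show ?thesis unfolding A B th[OF j] .
    qed
    show "F (\<lambda>j\<in>?I. c j * g j + s j * h j) (\<lambda>j\<in>?I. s j * g j - c j * h j) = ennreal (\<Sum>j\<in>?I. (g j * (d j / sqrt (v j) - cstar p d a * a j * sqrt (v j) / ?S g)
       - sqrt (\<gamma> j) * sqrt (d j) / sqrt (v j) * h j)\<^sup>2)"
      unfolding F_def by (intro arg_cong[where f=ennreal] sum.cong refl arg_cong[where f="\<lambda>x. x\<^sup>2"] t)
  qed
  finally show ?thesis
    by (simp only: nn_integral_PiM_stdn_sum_sq[OF finite_atLeastAtMost])
qed

text \<open>For a multiple \<open>k\<close> in place of \<open>cstar p d a = c\<close>, the linear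
  and quadratic terms together would be at most \<open>(k\<^sup>2 - 2 * k * c) * E[1 / S]\<close>,
  which is least at \<open>k = c\<close>. The sign of \<open>c\<close> matters because a lower bound
  on the linear expectation is multiplied by \<open>- 2 * c\<close>.\<close>

lemma bayes_risk_delta_A_le:
  assumes p: "p \<ge> 3" and d: "\<And>j. j \<in> {1..p} \<Longrightarrow> d j > 0" and \<gamma>: "\<And>j. j \<in> {1..p} \<Longrightarrow> \<gamma> j \<ge> 0"
    and a: "\<And>j. j \<in> {1..p} \<Longrightarrow> a j > 0" and c: "cstar p d a \<ge> 0"
  shows "bayes_risk p d \<gamma> (delta_A p d a) \<le>
    ennreal ((\<Sum>j\<in>{1..p}. d j) - (cstar p d a)\<^sup>2 * (real p / ((real p - 2) * (\<Sum>j\<in>{1..p}. (d j + \<gamma> j) * (a j)\<^sup>2))))"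
proof -
  let ?I = "{1..p}" let ?P = "PiM ?I (\<lambda>_. stdn)" let ?c = "cstar p d a"
  define v where "v j = d j + \<gamma> j" for j
  define s where "s k = (a k)\<^sup>2 * v k" for k
  let ?S = "wsq ?I s"
  interpret P: prob_space ?P by (rule prob_space_PiM_stdn)
  have v: "v j > 0" if "j \<in> ?I" for j using d[OF that] \<gamma>[OF that] by (simp add: v_def)
  have s: "s j > 0" if "j \<in> ?I" for j using v[OF that] a[OF that] by (simp add: s_def)
  have card: "card ?I \<ge> 3" using p by simp
  have int: "integrable ?P (\<lambda>x. 1 / ?S x)"
    by (rule integrable_inverse_wsq) (use card s in auto)
  have st: "(\<integral>x. (x j)\<^sup>2 / ?S x \<partial>?P) = (\<integral>x. 1 / ?S x \<partial>?P) - 2 * (\<integral>x. s j * (x j)\<^sup>2 / (?S x)\<^sup>2 \<partial>?P)"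
    "integrable ?P (\<lambda>x. (x j)\<^sup>2 / ?S x)" "integrable ?P (\<lambda>x. s j * (x j)\<^sup>2 / (?S x)\<^sup>2)" if "j \<in> ?I" for j
    by (rule stein_PiM; use that s int in simp)+
  let ?E = "\<integral>x. 1 / ?S x \<partial>?P"
  define H where "H g = (\<Sum>j\<in>?I. (d j)\<^sup>2 / v j * (g j)\<^sup>2) - 2 * ?c * (\<Sum>j\<in>?I. d j * a j * ((g j)\<^sup>2 / ?S g)) + ?c\<^sup>2 * (1 / ?S g)
      + (\<Sum>j\<in>?I. \<gamma> j * d j / v j)" for g
  have Heq: "(\<Sum>j\<in>?I. (g j * (d j / sqrt (v j) - ?c * a j * sqrt (v j) / ?S g))\<^sup>2
       + (sqrt (\<gamma> j) * sqrt (d j) / sqrt (v j))\<^sup>2) = H g" for g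
  proof -
    have "(g j * (d j / sqrt (v j) - ?c * a j * sqrt (v j) / ?S g))\<^sup>2
       + (sqrt (\<gamma> j) * sqrt (d j) / sqrt (v j))\<^sup>2 =
      (d j)\<^sup>2 / v j * (g j)\<^sup>2 - 2 * ?c * (d j * a j * ((g j)\<^sup>2 / ?S g)) + ?c\<^sup>2 * (s j * (g j)\<^sup>2 / (?S g)\<^sup>2) + \<gamma> j * d j / v j"
      if j: "j \<in> ?I" for j
    proof -
      define r where "r = sqrt (v j)"
      have r: "r > 0" "v j = r\<^sup>2" using v[OF j] by (auto simp: r_def)
      have "(sqrt (\<gamma> j) * sqrt (d j) / r)\<^sup>2 = \<gamma> j * d j / v j"
        using \<gamma>[OF j] d[OF j] r by (simp add: power_divide power_mult_distrib)
      moreover have "(g j * (d j / r - ?c * a j * r / ?S g))\<^sup>2 =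
         (d j)\<^sup>2 / v j * (g j)\<^sup>2 - 2 * ?c * (d j * a j * ((g j)\<^sup>2 / ?S g)) + ?c\<^sup>2 * (s j * (g j)\<^sup>2 / (?S g)\<^sup>2)"
      proof -
        have "(G * (D / r - c * A * r * q))\<^sup>2 = D\<^sup>2 / r\<^sup>2 * G\<^sup>2 - 2 * c * (D * A * (G\<^sup>2 * q)) + c\<^sup>2 * (A\<^sup>2 * r\<^sup>2 * G\<^sup>2 * q\<^sup>2)" for G D c A q
          using r(1) by (simp add: power2_eq_square field_simps)
        from this[of "g j" "d j" ?c "a j" "1 / ?S g"] show ?thesis
          by (simp add: s_def r(2) power_divide)
      qed
      ultimately show ?thesis unfolding r_def[symmetric] by simp
    qed
    then have "(\<Sum>j\<in>?I. (g j * (d j / sqrt (v j) - ?c * a j * sqrt (v j) / ?S g))\<^sup>2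
       + (sqrt (\<gamma> j) * sqrt (d j) / sqrt (v j))\<^sup>2) =
      (\<Sum>j\<in>?I. (d j)\<^sup>2 / v j * (g j)\<^sup>2 - 2 * ?c * (d j * a j * ((g j)\<^sup>2 / ?S g)) + ?c\<^sup>2 * (s j * (g j)\<^sup>2 / (?S g)\<^sup>2) + \<gamma> j * d j / v j)"
      by (intro sum.cong refl)
    also have "\<dots> = (\<Sum>j\<in>?I. (d j)\<^sup>2 / v j * (g j)\<^sup>2) - 2 * ?c * (\<Sum>j\<in>?I. d j * a j * ((g j)\<^sup>2 / ?S g))
       + ?c\<^sup>2 * (\<Sum>j\<in>?I. s j * (g j)\<^sup>2 / (?S g)\<^sup>2) + (\<Sum>j\<in>?I. \<gamma> j * d j / v j)"
      by (simp only: sum.distrib sum_subtractf sum_distrib_left)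
    also have "(\<Sum>j\<in>?I. s j * (g j)\<^sup>2 / (?S g)\<^sup>2) = ?S g / (?S g)\<^sup>2"
      by (simp only: sum_divide_distrib[symmetric] wsq_def)
    \<comment> \<open>Valid also where \<open>?S g = 0\<close>, both sides being 0 there.\<close>
    also have "\<dots> = 1 / ?S g" by (simp add: power2_eq_square)
    finally show ?thesis unfolding H_def .
  qed
  have H0: "H g \<ge> 0" for g unfolding Heq[symmetric] by (intro sum_nonneg) auto
  have i1: "integrable ?P (\<lambda>g. \<Sum>j\<in>?I. (d j)\<^sup>2 / v j * (g j)\<^sup>2)"
    by (intro Bochner_Integration.integrable_sum integrable_mult_right PiM_stdn_moments)
  have i2: "integrable ?P (\<lambda>g. \<Sum>j\<in>?I. d j * a j * ((g j)\<^sup>2 / ?S g))"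
    by (intro Bochner_Integration.integrable_sum integrable_mult_right st)
  have i2': "integrable ?P (\<lambda>g. 2 * ?c * (\<Sum>j\<in>?I. d j * a j * ((g j)\<^sup>2 / ?S g)))"
    by (intro integrable_mult_right i2)
  have i3: "integrable ?P (\<lambda>g. ?c\<^sup>2 * (1 / ?S g))"
    by (intro integrable_mult_right int)
  have i4: "integrable ?P (\<lambda>g. \<Sum>j\<in>?I. \<gamma> j * d j / v j)" by (rule P.integrable_const)
  note i12 = Bochner_Integration.integrable_diff[OF i1 i2']
  note i123 = Bochner_Integration.integrable_add[OF i12 i3]
  have iH: "integrable ?P H"
    unfolding H_def by (rule Bochner_Integration.integrable_add[OF i123 i4])
  have e1: "(\<integral>g. (\<Sum>j\<in>?I. (d j)\<^sup>2 / v j * (g j)\<^sup>2) \<partial>?P) = (\<Sum>j\<in>?I. (d j)\<^sup>2 / v j)"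
  proof -
    have "(\<integral>g. (\<Sum>j\<in>?I. (d j)\<^sup>2 / v j * (g j)\<^sup>2) \<partial>?P) = (\<Sum>j\<in>?I. \<integral>g. (d j)\<^sup>2 / v j * (g j)\<^sup>2 \<partial>?P)"
      by (rule Bochner_Integration.integral_sum) (intro integrable_mult_right PiM_stdn_moments)
    also have "\<dots> = (\<Sum>j\<in>?I. (d j)\<^sup>2 / v j)"
    proof (intro sum.cong refl)
      fix j assume j: "j \<in> ?I"
      show "(\<integral>g. (d j)\<^sup>2 / v j * (g j)\<^sup>2 \<partial>?P) = (d j)\<^sup>2 / v j"
        unfolding integral_mult_right_zero PiM_stdn_moments(4)[OF j] by simp
    qed
    finally show ?thesis .
  qed
  \<comment> \<open>By Stein's identity coordinate \<open>j\<close> loses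
    \<open>2 * d j * a j * ?q j\<close>. The \<open>?q j\<close> are nonnegative with sum
    \<open>?E\<close>, so replacing each \<open>d j * a j\<close> by \<open>M\<close> bounds the
    total loss by \<open>2 * M * ?E\<close>; this is the origin of the term \<open>2 * Max\<close>
    in \<open>cstar\<close>.\<close>
  have e2: "(\<integral>g. (\<Sum>j\<in>?I. d j * a j * ((g j)\<^sup>2 / ?S g)) \<partial>?P) \<ge> ?c * ?E"
  proof -
    define M where "M = Max ((\<lambda>j. d j * a j) ` ?I)"
    let ?q = "\<lambda>j. \<integral>x. s j * (x j)\<^sup>2 / (?S x)\<^sup>2 \<partial>?P"
    have q: "(\<Sum>j\<in>?I. ?q j) = ?E"
    proof -
      have "(\<Sum>j\<in>?I. ?q j) = (\<integral>x. (\<Sum>j\<in>?I. s j * (x j)\<^sup>2 / (?S x)\<^sup>2) \<partial>?P)"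
        by (rule Bochner_Integration.integral_sum[symmetric]) (rule st)
      also have "\<dots> = ?E"
      proof (intro Bochner_Integration.integral_cong refl)
        fix x
        have "(\<Sum>j\<in>?I. s j * (x j)\<^sup>2 / (?S x)\<^sup>2) = ?S x / (?S x)\<^sup>2"
          by (simp only: sum_divide_distrib[symmetric] wsq_def)
        then show "(\<Sum>j\<in>?I. s j * (x j)\<^sup>2 / (?S x)\<^sup>2) = 1 / ?S x" by (simp add: power2_eq_square)
      qed
      finally show ?thesis .
    qed
    have "(\<integral>g. (\<Sum>j\<in>?I. d j * a j * ((g j)\<^sup>2 / ?S g)) \<partial>?P) = (\<Sum>j\<in>?I. \<integral>g. d j * a j * ((g j)\<^sup>2 / ?S g) \<partial>?P)"
      by (rule Bochner_Integration.integral_sum) (intro integrable_mult_right st)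
    also have "\<dots> = (\<Sum>j\<in>?I. d j * a j * (?E - 2 * ?q j))"
    proof (intro sum.cong refl)
      fix j assume j: "j \<in> ?I"
      show "(\<integral>g. d j * a j * ((g j)\<^sup>2 / ?S g) \<partial>?P) = d j * a j * (?E - 2 * ?q j)"
        unfolding integral_mult_right_zero st(1)[OF j] ..
    qed
    also have "\<dots> \<ge> (\<Sum>j\<in>?I. d j * a j * ?E - 2 * (M * ?q j))"
    proof (intro sum_mono)
      fix j assume j: "j \<in> ?I"
      have "d j * a j \<le> M" unfolding M_def using j by (intro Max_ge) auto
      moreover have "?q j \<ge> 0" using s[OF j] by (intro Bochner_Integration.integral_nonneg) auto
      ultimately have "d j * a j * ?q j \<le> M * ?q j" by (rule mult_right_mono)
      then show "d j * a j * ?E - 2 * (M * ?q j) \<le> d j * a j * (?E - 2 * ?q j)"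
        by (simp add: right_diff_distrib)
    qed
    also have "(\<Sum>j\<in>?I. d j * a j * ?E - 2 * (M * ?q j)) = (\<Sum>j\<in>?I. d j * a j) * ?E - 2 * (M * (\<Sum>j\<in>?I. ?q j))"
      by (simp only: sum_subtractf sum_distrib_left sum_distrib_right)
    also have "\<dots> = ?c * ?E" unfolding q cstar_def M_def by (simp add: left_diff_distrib)
    finally show ?thesis .
  qed
  have dsum: "(\<Sum>j\<in>?I. (d j)\<^sup>2 / v j) + (\<Sum>j\<in>?I. \<gamma> j * d j / v j) = (\<Sum>j\<in>?I. d j)"
    unfolding sum.distrib[symmetric]
  proof (intro sum.cong refl)
    fix j assume j: "j \<in> ?I"
    have "(d j)\<^sup>2 / v j + \<gamma> j * d j / v j = d j * v j / v j"
      by (simp add: v_def power2_eq_square add_divide_distrib[symmetric] algebra_simps)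
    then show "(d j)\<^sup>2 / v j + \<gamma> j * d j / v j = d j" using v[OF j] by simp
  qed
  have "integral\<^sup>L ?P H = (\<Sum>j\<in>?I. (d j)\<^sup>2 / v j) - 2 * ?c * (\<integral>g. (\<Sum>j\<in>?I. d j * a j * ((g j)\<^sup>2 / ?S g)) \<partial>?P)
     + ?c\<^sup>2 * ?E + (\<Sum>j\<in>?I. \<gamma> j * d j / v j)"
    unfolding H_def
    by (simp only: Bochner_Integration.integral_add[OF i123 i4] Bochner_Integration.integral_add[OF i12 i3]
       Bochner_Integration.integral_diff[OF i1 i2'] e1 integral_mult_right_zero) (simp add: P.prob_space[unfolded One_nat_def])
  also have "\<dots> \<le> (\<Sum>j\<in>?I. (d j)\<^sup>2 / v j) - 2 * ?c * (?c * ?E) + ?c\<^sup>2 * ?E + (\<Sum>j\<in>?I. \<gamma> j * d j / v j)"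
    using mult_left_mono[OF e2, of "2 * ?c"] c by simp
  also have "\<dots> = (\<Sum>j\<in>?I. d j) - ?c\<^sup>2 * ?E"
    unfolding dsum[symmetric] by (simp add: power2_eq_square)
  also have "\<dots> \<le> (\<Sum>j\<in>?I. d j) - ?c\<^sup>2 * (real p / ((real p - 2) * (\<Sum>j\<in>?I. (d j + \<gamma> j) * (a j)\<^sup>2)))"
  proof -
    have "?E \<ge> real (card ?I) / ((real (card ?I) - 2) * (\<Sum>k\<in>?I. s k))"
      by (rule integral_inverse_wsq_ge) (use card s in auto)
    then have "?E \<ge> real p / ((real p - 2) * (\<Sum>j\<in>?I. (d j + \<gamma> j) * (a j)\<^sup>2))"
      by (simp add: s_def v_def mult.commute)
    from mult_left_mono[OF this, of "?c\<^sup>2"] show ?thesis by simp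
  qed
  finally have "integral\<^sup>L ?P H \<le> (\<Sum>j\<in>?I. d j) - ?c\<^sup>2 * (real p / ((real p - 2) * (\<Sum>j\<in>?I. (d j + \<gamma> j) * (a j)\<^sup>2)))" .
  moreover have "bayes_risk p d \<gamma> (delta_A p d a) = ennreal (integral\<^sup>L ?P H)"
  proof -
    have "bayes_risk p d \<gamma> (delta_A p d a) = (\<integral>\<^sup>+ g. ennreal (H g) \<partial>?P)"
      unfolding Heq[symmetric] s_def v_def by (rule bayes_risk_eq_rotated) (use d \<gamma> in auto)
    then show ?thesis using iH H0 by (simp add: nn_integral_eq_integral)
  qed
  ultimately show ?thesis by (simp add: ennreal_leI)
qed

subsection \<open>The maximizer\<close>

text \<open>Passing from \<open>k\<close> to \<open>k + 1\<close> loses \<open>D (k + 1) * t\<^sup>2 / (u * (u + 1))\<close>, the defect in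
  the Cauchy-Schwarz inequality. The assumption on the last index gives \<open>0 \<le> t \<le> 2\<close>, hence a loss of
  at most \<open>4 * D (k + 1) / (k * (k + 1))\<close>, and these losses telescope.\<close>

lemma harmonic_sum_bound:
  fixes D :: "nat \<Rightarrow> real"
  assumes pos: "\<And>j. 1 \<le> j \<Longrightarrow> j \<le> n \<Longrightarrow> D j > 0"
    and anti: "\<And>i j. 1 \<le> i \<Longrightarrow> i \<le> j \<Longrightarrow> j \<le> n \<Longrightarrow> D j \<le> D i"
    and last: "real n - 2 \<le> D n * (\<Sum>j\<in>{1..n}. 1 / D j)"
    and k: "4 \<le> k" "k \<le> n"
  shows "(\<Sum>j\<in>{5..k}. D j) + 4 * D k / real k \<le> (real k - 2)\<^sup>2 / (\<Sum>j\<in>{1..k}. 1 / D j)"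
  using k
proof (induction k rule: nat_induct_at_least)
  case base
  \<comment> \<open>At \<open>k = 4\<close> the sum over \<open>{5..4}\<close> is empty and the
    claim reads \<open>D 4 \<le> (4 - 2)\<^sup>2 / W\<close> for the sum \<open>W\<close> of four
    reciprocals, each at most \<open>1 / D 4\<close>.\<close>
  have "(\<Sum>j\<in>{1..4}. 1 / D j) \<le> (\<Sum>j\<in>{1..4::nat}. 1 / D 4)"
    using base by (intro sum_mono frac_le pos anti) auto
  then have W: "(\<Sum>j\<in>{1..4}. 1 / D j) \<le> 4 / D 4" by simp
  have D4: "D 4 > 0" using base by (intro pos) auto
  have W0: "(\<Sum>j\<in>{1..4}. 1 / D j) > 0" using base by (intro sum_pos) (auto intro!: pos)
  have "D 4 * (\<Sum>j\<in>{1..4}. 1 / D j) \<le> 4" using W D4 by (simp add: field_simps)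
  then have "D 4 \<le> 4 / (\<Sum>j\<in>{1..4}. 1 / D j)" using W0 by (simp add: pos_le_divide_eq)
  then show ?case by simp
next
  case (Suc k)
  define W where "W = (\<Sum>j\<in>{1..k}. 1 / D j)"
  define E where "E = D (Suc k)"
  define u where "u = W * E"
  have kn: "Suc k \<le> n" and k4: "4 \<le> k" using Suc by auto
  have E: "E > 0" unfolding E_def using kn by (intro pos) auto
  have WS: "(\<Sum>j\<in>{1..Suc k}. 1 / D j) = W + 1 / E" by (simp add: W_def E_def)
  have u_le: "u \<le> real k"
  proof -
    have "W \<le> (\<Sum>j\<in>{1..k}. 1 / E)"
      unfolding W_def E_def using kn by (intro sum_mono frac_le pos anti) auto
    then show ?thesis using E by (simp add: u_def field_simps)
  qed
  \<comment> \<open>The hypothesis on \<open>n\<close> descends to \<open>k + 1\<close>: the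
    reciprocals beyond \<open>k + 1\<close> are at most \<open>1 / D n\<close> each, so the first
    \<open>k + 1\<close> of them still sum to at least \<open>(k - 1) / D n\<close>, and
    \<open>D n \<le> E\<close>.\<close>
  have u_ge: "real k - 2 \<le> u"
  proof -
    have Dn: "D n > 0" using kn by (intro pos) auto
    have split: "{1..n} = {1..Suc k} \<union> {Suc (Suc k)..n}" using kn by auto
    have "(\<Sum>j\<in>{Suc (Suc k)..n}. 1 / D j) \<le> (\<Sum>j\<in>{Suc (Suc k)..n}. 1 / D n)"
      by (intro sum_mono frac_le) (auto intro!: anti Dn)
    also have "\<dots> = (real n - real k - 1) / D n" using kn by (simp add: of_nat_diff)
    finally have a: "(\<Sum>j\<in>{Suc (Suc k)..n}. 1 / D j) \<le> (real n - real k - 1) / D n" .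
    have b: "(real n - 2) / D n \<le> (\<Sum>j\<in>{1..n}. 1 / D j)"
      using last Dn by (simp add: field_simps)
    have "(\<Sum>j\<in>{1..n}. 1 / D j) = W + 1 / E + (\<Sum>j\<in>{Suc (Suc k)..n}. 1 / D j)"
      unfolding split WS[symmetric] by (rule sum.union_disjoint) auto
    with a b have "(real n - 2) / D n - (real n - real k - 1) / D n \<le> W + 1 / E" by linarith
    then have "(real k - 1) / D n \<le> W + 1 / E" by (simp add: diff_divide_distrib[symmetric])
    moreover have "(real k - 1) / E \<le> (real k - 1) / D n"
      unfolding E_def using kn k4 Dn by (intro divide_left_mono anti mult_pos_pos pos) auto
    ultimately have "(real k - 1) / E \<le> W + 1 / E" by linarith
    also have "W + 1 / E = (u + 1) / E" using E by (simp add: u_def field_simps)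
    finally show ?thesis using E by (simp add: divide_le_cancel)
  qed
  have u0: "u > 0" using u_ge k4 by simp
  have W: "W = u / E" "W + 1 / E = (u + 1) / E" using E by (simp_all add: u_def field_simps)
  define t where "t = u - (real k - 2)"
  have t: "0 \<le> t" "t \<le> 2" using u_ge u_le by (auto simp: t_def)
  \<comment> \<open>Both factors of \<open>u * (u + 1)\<close> are bounded separately:
    \<open>u - t * k / 2 = (k / 2 - 1) * (2 - t)\<close> and
    \<open>u + 1 - t * (k + 1) / 2 = (k - 1) * (2 - t) / 2\<close>.\<close>
  have "t * real k / 2 \<le> u"
  proof -
    have "(t - 2) * (real k / 2 - 1) \<le> 0" using t k4 by (intro mult_nonpos_nonneg) auto
    then show ?thesis by (simp add: t_def field_simps)
  qed
  moreover have "t * (real k + 1) / 2 \<le> u + 1"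
  proof -
    have "(t - 2) * (real k - 1) \<le> 0" using t k4 by (intro mult_nonpos_nonneg) auto
    then show ?thesis by (simp add: t_def field_simps)
  qed
  ultimately have "(t * real k / 2) * (t * (real k + 1) / 2) \<le> u * (u + 1)"
    using t u0 by (intro mult_mono) auto
  then have "t\<^sup>2 * (real k * (real k + 1)) \<le> 4 * (u * (u + 1))"
    by (simp add: power2_eq_square algebra_simps)
  then have t2: "t\<^sup>2 / (u * (u + 1)) \<le> 4 / (real k * (real k + 1))"
    using u0 k4 by (intro mult_imp_div_pos_le) (simp_all add: pos_le_divide_eq)
  have id: "(real k - 1)\<^sup>2 / (u + 1) = (real k - 2)\<^sup>2 / u + 1 - t\<^sup>2 / (u * (u + 1))"
  proof -
    define m where "m = real k - 2"
    have "(m + 1)\<^sup>2 * u = m\<^sup>2 * (u + 1) + u * (u + 1) - (u - m)\<^sup>2"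
      by (simp add: power2_eq_square algebra_simps)
    then have "(m + 1)\<^sup>2 * u / (u * (u + 1)) =
        m\<^sup>2 * (u + 1) / (u * (u + 1)) + u * (u + 1) / (u * (u + 1)) - (u - m)\<^sup>2 / (u * (u + 1))"
      by (simp only: add_divide_distrib diff_divide_distrib)
    moreover have "m\<^sup>2 * (u + 1) / (u * (u + 1)) = m\<^sup>2 / u" "(m + 1)\<^sup>2 * u / (u * (u + 1)) = (m + 1)\<^sup>2 / (u + 1)"
      "u * (u + 1) / (u * (u + 1)) = 1"
      using u0 by simp_all
    moreover have "m + 1 = real k - 1" "u - m = t" by (simp_all add: m_def t_def)
    ultimately show ?thesis by (simp only: m_def)
  qed
  have "(real (Suc k) - 2)\<^sup>2 / (\<Sum>j\<in>{1..Suc k}. 1 / D j) = E * ((real k - 1)\<^sup>2 / (u + 1))"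
    unfolding WS W(2) using E by (simp add: field_simps)
  also have "\<dots> = (real k - 2)\<^sup>2 / W + E - E * (t\<^sup>2 / (u * (u + 1)))"
    unfolding id W(1) using E by (simp add: algebra_simps)
  also have "\<dots> \<ge> (real k - 2)\<^sup>2 / W + E - E * (4 / (real k * (real k + 1)))"
    using mult_left_mono[OF t2, of E] E by simp
  also have "(real k - 2)\<^sup>2 / W + E - E * (4 / (real k * (real k + 1))) \<ge>
     (\<Sum>j\<in>{5..k}. D j) + 4 * D k / real k + E - E * (4 / (real k * (real k + 1)))"
    using Suc.IH kn by (simp add: W_def)
  also have "(\<Sum>j\<in>{5..k}. D j) + 4 * D k / real k + E - E * (4 / (real k * (real k + 1))) \<ge>
     (\<Sum>j\<in>{5..k}. D j) + 4 * E / real k + E - E * (4 / (real k * (real k + 1)))"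
  proof -
    have "E \<le> D k" unfolding E_def using kn k4 by (intro anti) auto
    then have "4 * E / real k \<le> 4 * D k / real k" by (intro divide_right_mono) auto
    then show ?thesis by simp
  qed
  also have "(\<Sum>j\<in>{5..k}. D j) + 4 * E / real k + E - E * (4 / (real k * (real k + 1))) =
     (\<Sum>j\<in>{5..Suc k}. D j) + 4 * D (Suc k) / real (Suc k)"
  proof -
    have "4 * E / real k - E * (4 / (real k * (real k + 1))) = 4 * E / (real k + 1)"
    proof -
      have "4 * E / r = 4 * E * (r + 1) / (r * (r + 1))" "4 * E / (r + 1) = 4 * E * r / (r * (r + 1))" if "r > 0" for r
        using that by simp_all
      from this[of "real k"] show ?thesis
        using k4 by (simp add: diff_divide_distrib[symmetric] algebra_simps)
    qed
    moreover have "(\<Sum>j\<in>{5..Suc k}. D j) = (\<Sum>j\<in>{5..k}. D j) + E"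
      using k4 by (simp add: E_def)
    ultimately show ?thesis by (simp add: E_def add.commute)
  qed
  finally show ?case .
qed

section \<open>Shape and value of the optimal weights\<close>

locale cstar_maximizer =
  fixes p :: nat and d \<gamma> a :: "nat \<Rightarrow> real"
  assumes p3: "p \<ge> 3"
    and dpos: "\<And>j. j \<in> {1..p} \<Longrightarrow> d j > 0"
    and gnn: "\<And>j. j \<in> {1..p} \<Longrightarrow> \<gamma> j \<ge> 0"
    and feas: "feasible p d \<gamma> a"
    and maxi: "\<And>b. feasible p d \<gamma> b \<Longrightarrow> cstar p d b \<le> cstar p d a"
begin

abbreviation "D \<equiv> dstar d \<gamma>"
abbreviation "T \<equiv> \<Sum>j\<in>{1..p}. D j"
abbreviation "N b \<equiv> \<Sum>j\<in>{1..p}. (d j + \<gamma> j) * (b j)\<^sup>2"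
abbreviation "C \<equiv> cstar p d a"
abbreviation "M \<equiv> Max ((\<lambda>j. d j * a j) ` {1..p})"
text \<open>The inverse Lagrange multiplier of the constraint, in closed form thanks to homogeneity:
  along the ray \<open>r * a\<close> the penalized functional with this \<open>lam\<close> is
  \<open>r * C - r\<^sup>2 * C / 2\<close>, which is stationary at \<open>r = 1\<close>.\<close>

definition "lam = T / C"

lemma D_pos: "j \<in> {1..p} \<Longrightarrow> D j > 0"
  using dpos[of j] gnn[of j] by (simp add: dstar_def)

lemma T_pos: "T > 0"
  using p3 by (intro sum_pos D_pos) auto

lemma a_nonneg: "j \<in> {1..p} \<Longrightarrow> a j \<ge> 0"
  using feas by (simp add: feasible_def)

lemma N_a: "N a = T"
  using feas by (simp add: feasible_def)

text \<open>In the coordinates \<open>d j * x\<close> the constraint has the weights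
  \<open>1 / D j\<close>, so \<open>d\<close> and \<open>\<gamma>\<close> enter the optimisation
  only through \<open>D\<close>.\<close>

lemma weight_eq: "j \<in> {1..p} \<Longrightarrow> (d j + \<gamma> j) * x\<^sup>2 = (d j * x)\<^sup>2 / D j"
  using dpos[of j] gnn[of j] by (simp add: dstar_def power_mult_distrib)

lemma cstar_scale:
  assumes "r \<ge> 0"
  shows "r * cstar p d b \<le> cstar p d (\<lambda>j. r * b j)"
proof -
  have "Max ((\<lambda>j. d j * (r * b j)) ` {1..p}) \<le> r * Max ((\<lambda>j. d j * b j) ` {1..p})"
  proof (rule Max.boundedI)
    fix y assume "y \<in> (\<lambda>j. d j * (r * b j)) ` {1..p}"
    then obtain j where j: "j \<in> {1..p}" "y = r * (d j * b j)" by (auto simp: mult.left_commute)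
    show "y \<le> r * Max ((\<lambda>j. d j * b j) ` {1..p})"
      unfolding j(2) using assms j by (intro mult_left_mono Max_ge) auto
  qed (use p3 in auto)
  moreover have "(\<Sum>j\<in>{1..p}. d j * (r * b j)) = r * (\<Sum>j\<in>{1..p}. d j * b j)"
    by (simp add: sum_distrib_left mult.left_commute)
  ultimately show ?thesis by (simp add: cstar_def right_diff_distrib)
qed

text \<open>Rescaling to the surface \<open>N = T\<close> makes any nonnegative nonzero competitor
  feasible, so the constraint is traded for a scalar factor.\<close>

lemma cstar_scaled_le:
  assumes b: "\<And>j. j \<in> {1..p} \<Longrightarrow> b j \<ge> 0" and N: "N b > 0"
  shows "sqrt (T / N b) * cstar p d b \<le> C"
proof -
  let ?r = "sqrt (T / N b)"
  have r: "?r \<ge> 0" "?r\<^sup>2 = T / N b" using T_pos N by auto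
  have "N (\<lambda>j. ?r * b j) = ?r\<^sup>2 * N b"
    by (simp only: sum_distrib_left power_mult_distrib) (intro sum.cong refl, simp)
  also have "\<dots> = T" unfolding r(2) using N by simp
  finally have "feasible p d \<gamma> (\<lambda>j. ?r * b j)"
    using b r(1) by (simp add: feasible_def)
  from maxi[OF this] cstar_scale[OF r(1), of b] show ?thesis by linarith
qed

lemma C_pos: "C > 0"
proof -
  \<comment> \<open>With these weights every \<open>d j * ?b j\<close> is 1, so \<open>cstar\<close>
    equals \<open>p - 2\<close>, positive in dimension at least three.\<close>
  let ?b = "\<lambda>j. 1 / d j"
  have nz: "d j * ?b j = 1" if "j \<in> {1..p}" for j using dpos[OF that] by simp
  have N: "N ?b > 0"
    using p3 by (intro sum_pos) (auto intro!: mult_pos_pos add_pos_nonneg dpos gnn simp: less_imp_neq[OF dpos, symmetric])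
  have "(\<lambda>j. d j * ?b j) ` {1..p} = (\<lambda>_. 1) ` {1..p}"
    using nz by (rule image_cong[OF refl])
  also have "\<dots> = {1}" using p3 by (simp add: image_constant_conv)
  finally have "(\<lambda>j. d j * ?b j) ` {1..p} = {1}" .
  then have e: "cstar p d ?b = real p - 2"
  proof -
    assume img: "(\<lambda>j. d j * ?b j) ` {1..p} = {1}"
    have "(\<Sum>j\<in>{1..p}. d j * ?b j) = (\<Sum>j\<in>{1..p}. 1)" by (intro sum.cong refl nz)
    then show ?thesis unfolding cstar_def img by simp
  qed
  have l: "sqrt (T / N ?b) * cstar p d ?b \<le> C"
    by (rule cstar_scaled_le) (use N dpos in \<open>auto simp: less_imp_le\<close>)
  have "sqrt (T / N ?b) * (real p - 2) > 0"
    using p3 N T_pos by (intro mult_pos_pos) auto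
  from less_le_trans[OF this l[unfolded e]] show ?thesis .
qed

lemma lam_pos: "lam > 0"
  using C_pos T_pos by (simp add: lam_def)

text \<open>By homogeneity and AM-GM the constrained maximizer also maximizes the unconstrained
  concave functional \<open>cstar p d b - N b / (2 * lam)\<close>.\<close>

lemma cstar_le_penalized:
  assumes b: "\<And>j. j \<in> {1..p} \<Longrightarrow> b j \<ge> 0"
  shows "cstar p d b \<le> C / 2 + N b / (2 * lam)"
proof -
  have N0: "N b \<ge> 0" by (intro sum_nonneg mult_nonneg_nonneg add_nonneg_nonneg less_imp_le[OF dpos] gnn) auto
  show ?thesis
  proof (cases "N b = 0")
    case True
    have z: "b j = 0" if "j \<in> {1..p}" for j
    proof -
      have "(d j + \<gamma> j) * (b j)\<^sup>2 = 0"
        using True that by (subst (asm) sum_nonneg_eq_0_iff) (auto intro!: mult_nonneg_nonneg add_nonneg_nonneg less_imp_le[OF dpos] gnn)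
      then show ?thesis using dpos[OF that] gnn[OF that] by simp
    qed
    have "(\<lambda>j. d j * b j) ` {1..p} = {0}"
      using image_cong[of "{1..p}" "{1..p}" "\<lambda>j. d j * b j" "\<lambda>_. 0"] z p3 by (simp add: image_constant_conv)
    then have "cstar p d b = 0" using z by (simp add: cstar_def)
    then show ?thesis using C_pos True by simp
  next
    case False
    then have N: "N b > 0" using N0 by simp
    define q where "q = sqrt (N b / T)"
    have q: "q > 0" "q\<^sup>2 = N b / T" using N T_pos by (auto simp: q_def)
    have "sqrt (T / N b) = 1 / q" unfolding q_def by (simp add: real_sqrt_divide)
    with cstar_scaled_le[OF b N] have "1 / q * cstar p d b \<le> C" by simp
    then have "cstar p d b \<le> C * q" using q(1) by (simp add: pos_divide_le_eq)
    also have "\<dots> \<le> C * ((1 + q\<^sup>2) / 2)"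
    proof (intro mult_left_mono)
      have "0 \<le> (q - 1)\<^sup>2" by simp
      then show "q \<le> (1 + q\<^sup>2) / 2" by (simp add: power2_eq_square algebra_simps)
    qed (use C_pos in simp)
    also have "\<dots> = C / 2 + N b / (2 * lam)" unfolding q(2) lam_def using C_pos T_pos by (simp add: field_simps)
    finally show ?thesis .
  qed
qed

lemma le_M: "j \<in> {1..p} \<Longrightarrow> d j * a j \<le> M"
  by (intro Max_ge) auto

lemma M_pos: "M > 0"
proof (rule ccontr)
  assume "\<not> M > 0"
  then have M: "M \<le> 0" by simp
  have z: "d j * a j = 0" if "j \<in> {1..p}" for j
    using le_M[OF that] M mult_nonneg_nonneg[OF less_imp_le[OF dpos[OF that]] a_nonneg[OF that]] by linarith
  have "M \<ge> 0" using le_M[of 1] z[of 1] p3 by simp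
  with M have "M = 0" by simp
  moreover have "(\<Sum>j\<in>{1..p}. d j * a j) = 0" using z by (rule sum.neutral[OF ballI])
  ultimately have "C = 0" unfolding cstar_def by linarith
  with C_pos show False by linarith
qed

text \<open>Coordinate \<open>j\<close> alone is moved to a value \<open>x\<close> in the interval
  from 0 to \<open>M\<close>. The maximum does not rise, so \<open>cstar\<close> changes by at least
  \<open>x - d j * a j\<close>, and comparison with the penalized bound completes to squares:
  \<open>d j * a j\<close> is the point of that interval closest to
  \<open>lam * D j\<close>.\<close>

lemma maximizer_eq:
  assumes j: "j \<in> {1..p}"
  shows "d j * a j = min M (lam * D j)"
proof -
  define L where "L = lam * D j"
  have L: "L > 0" using lam_pos D_pos[OF j] by (simp add: L_def)
  let ?b = "d j * a j"
  have key: "(?b - L)\<^sup>2 \<le> (x - L)\<^sup>2" if x: "0 \<le> x" "x \<le> M" for x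
  proof -
    define b where "b = a(j := x / d j)"
    have bj: "d j * b j = x" using dpos[OF j] by (simp add: b_def)
    have bn: "b i = a i" if "i \<noteq> j" for i using that by (simp add: b_def)
    have b0: "b i \<ge> 0" if "i \<in> {1..p}" for i
      using a_nonneg[OF that] dpos[OF j] x by (simp add: b_def)
    have "Max ((\<lambda>j. d j * b j) ` {1..p}) \<le> M"
    proof (rule Max.boundedI)
      fix y assume "y \<in> (\<lambda>j. d j * b j) ` {1..p}"
      then obtain i where i: "i \<in> {1..p}" "y = d i * b i" by auto
      show "y \<le> M" using i le_M[OF i(1)] bj x bn[of i] by (cases "i = j") auto
    qed (use p3 in auto)
    moreover have "(\<Sum>i\<in>{1..p}. d i * b i) = (\<Sum>i\<in>{1..p}. d i * a i) + (x - ?b)"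
    proof -
      have "(\<Sum>i\<in>{1..p} - {j}. d i * b i) = (\<Sum>i\<in>{1..p} - {j}. d i * a i)"
        by (intro sum.cong refl) (auto simp: bn)
      then show ?thesis using bj sum.remove[OF finite_atLeastAtMost j, of "\<lambda>i. d i * b i"]
          sum.remove[OF finite_atLeastAtMost j, of "\<lambda>i. d i * a i"] by linarith
    qed
    ultimately have "C + (x - ?b) \<le> cstar p d b" by (simp add: cstar_def)
    also have "\<dots> \<le> C / 2 + N b / (2 * lam)" using cstar_le_penalized b0 by blast
    also have "N b = T + (x\<^sup>2 - ?b\<^sup>2) / D j"
    proof -
      have "(\<Sum>i\<in>{1..p} - {j}. (d i + \<gamma> i) * (b i)\<^sup>2) = (\<Sum>i\<in>{1..p} - {j}. (d i + \<gamma> i) * (a i)\<^sup>2)"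
        by (intro sum.cong refl) (auto simp: bn)
      then have "N b - N a = (d j + \<gamma> j) * (b j)\<^sup>2 - (d j + \<gamma> j) * (a j)\<^sup>2"
        using sum.remove[OF finite_atLeastAtMost j, of "\<lambda>i. (d i + \<gamma> i) * (b i)\<^sup>2"]
          sum.remove[OF finite_atLeastAtMost j, of "\<lambda>i. (d i + \<gamma> i) * (a i)\<^sup>2"] by linarith
      then have "N b - T = x\<^sup>2 / D j - ?b\<^sup>2 / D j"
        unfolding N_a weight_eq[OF j] bj .
      then show ?thesis by (simp add: diff_divide_distrib)
    qed
    also have "C / 2 + (T + (x\<^sup>2 - ?b\<^sup>2) / D j) / (2 * lam) = C + (x\<^sup>2 - ?b\<^sup>2) / (2 * L)"
    proof -
      have "T / (2 * lam) = C / 2" using T_pos C_pos by (simp add: lam_def)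
      moreover have "(T + (x\<^sup>2 - ?b\<^sup>2) / D j) / (2 * lam) = T / (2 * lam) + (x\<^sup>2 - ?b\<^sup>2) / (2 * L)"
        by (simp add: add_divide_distrib L_def mult_ac)
      ultimately show ?thesis by linarith
    qed
    finally have "x - ?b \<le> (x\<^sup>2 - ?b\<^sup>2) / (2 * L)" by simp
    then have "2 * L * (x - ?b) \<le> x\<^sup>2 - ?b\<^sup>2" using L by (simp add: field_simps)
    then show ?thesis by (simp add: power2_eq_square algebra_simps)
  qed
  \<comment> \<open>The competitor is \<open>x = L\<close> if it lies in the interval, and otherwise
    the endpoint \<open>x = M\<close>.\<close>
  have "?b = min M L"
  proof (cases "L \<le> M")
    case True
    then have "(?b - L)\<^sup>2 \<le> 0" using key[of L] L by simp
    then show ?thesis using True by simp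
  next
    case False
    then have "(L - ?b)\<^sup>2 \<le> (L - M)\<^sup>2" using key[of M] M_pos by (simp add: power2_commute)
    then have "L - ?b \<le> L - M" by (rule power2_le_imp_le) (use False in linarith)
    then show ?thesis using False le_M[OF j] by linarith
  qed
  then show ?thesis by (simp add: L_def)
qed

text \<open>Makes all weights of the quadratic form strictly positive, as the inverse-moment
  estimates require.\<close>

lemma a_pos: "j \<in> {1..p} \<Longrightarrow> a j > 0"
proof -
  assume j: "j \<in> {1..p}"
  have "d j * a j > 0" using maximizer_eq[OF j] M_pos lam_pos D_pos[OF j] by simp
  then show "a j > 0" using dpos[OF j] by (simp add: zero_less_mult_iff)
qed

lemma nu_idx_props:
  shows "nu_idx p d a \<in> {1..p}" "d (nu_idx p d a) * a (nu_idx p d a) = M"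
    "\<And>j. j \<in> {1..p} \<Longrightarrow> nu_idx p d a < j \<Longrightarrow> d j * a j < M"
proof -
  let ?Q = "\<lambda>k. k \<in> {1..p} \<and> d k * a k = M"
  have "M \<in> (\<lambda>j. d j * a j) ` {1..p}" using p3 by (intro Max_in) auto
  then obtain k where k: "?Q k" by auto
  have Q: "?Q (nu_idx p d a)" unfolding nu_idx_def by (rule GreatestI_nat[of ?Q, OF k]) auto
  then show "nu_idx p d a \<in> {1..p}" "d (nu_idx p d a) * a (nu_idx p d a) = M" by auto
  fix j assume j: "j \<in> {1..p}" "nu_idx p d a < j"
  have "d j * a j \<noteq> M"
  proof
    assume "d j * a j = M"
    then have "j \<le> nu_idx p d a" unfolding nu_idx_def using j(1) by (intro Greatest_le_nat[of ?Q _ p]) auto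
    with j show False by simp
  qed
  with le_M[OF j(1)] show "d j * a j < M" by simp
qed

text \<open>Sorting turns \<open>min M (lam * D j)\<close> into a head with constant value
  \<open>M\<close> and a tail \<open>lam * D j\<close>, switching after index \<open>n\<close>. With
  tail sum \<open>S\<close> this gives \<open>C = (n - 2) * M + lam * S\<close> and
  \<open>T = M\<^sup>2 * W + lam\<^sup>2 * S\<close>; since \<open>T = lam * C\<close>, the tail
  cancels and \<open>M * W = lam * (n - 2)\<close>. The second claim restates
  \<open>M \<le> lam * D n\<close> and is what \<open>harmonic_sum_bound\<close> asks of the last
  index.\<close>

lemma maximizer_value:
  assumes sorted: "\<And>i j. 1 \<le> i \<Longrightarrow> i \<le> j \<Longrightarrow> j \<le> p \<Longrightarrow> D j \<le> D i"
  defines "n \<equiv> nu_idx p d a"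
  defines "W \<equiv> \<Sum>j\<in>{1..n}. 1 / D j"
  shows "C\<^sup>2 / T = (real n - 2)\<^sup>2 / W + (\<Sum>j\<in>{n+1..p}. D j)"
    and "real n - 2 \<le> D n * W"
proof -
  have n: "n \<in> {1..p}" "d n * a n = M" "\<And>j. j \<in> {1..p} \<Longrightarrow> n < j \<Longrightarrow> d j * a j < M"
    unfolding n_def by (rule nu_idx_props; assumption?)+
  have Mn: "M \<le> lam * D n" using maximizer_eq[OF n(1)] n(2) by linarith
  have lo: "d j * a j = M" if "j \<in> {1..n}" for j
  proof -
    have "lam * D n \<le> lam * D j" using sorted[of j n] that n(1) lam_pos by (intro mult_left_mono) auto
    moreover have "j \<in> {1..p}" using that n(1) by auto
    ultimately show ?thesis using Mn maximizer_eq[of j] by linarith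
  qed
  have hi: "d j * a j = lam * D j" if "j \<in> {n+1..p}" for j
    using n(3)[of j] maximizer_eq[of j] that by (auto simp: min_def split: if_splits)
  have split: "{1..p} = {1..n} \<union> {n+1..p}" using n(1) by auto
  have W0: "W > 0" unfolding W_def using n(1) by (intro sum_pos) (auto intro!: divide_pos_pos D_pos)
  let ?S = "\<Sum>j\<in>{n+1..p}. D j"
  have "(\<Sum>j\<in>{1..p}. d j * a j) = (\<Sum>j\<in>{1..n}. d j * a j) + (\<Sum>j\<in>{n+1..p}. d j * a j)"
    unfolding split by (rule sum.union_disjoint) auto
  also have "\<dots> = real n * M + lam * ?S"
  proof -
    have "(\<Sum>j\<in>{1..n}. d j * a j) = (\<Sum>j\<in>{1..n}. M)" by (rule sum.cong[OF refl lo])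
    also have "\<dots> = real n * M" unfolding sum_constant by simp
    finally have "(\<Sum>j\<in>{1..n}. d j * a j) = real n * M" .
    moreover have "(\<Sum>j\<in>{n+1..p}. d j * a j) = lam * ?S"
      unfolding sum_distrib_left by (rule sum.cong[OF refl hi])
    ultimately show ?thesis by (rule arg_cong2)
  qed
  finally have Ceq: "C = (real n - 2) * M + lam * ?S"
    unfolding cstar_def by (simp add: left_diff_distrib)
  have "T = (\<Sum>j\<in>{1..p}. (d j * a j)\<^sup>2 / D j)"
    unfolding N_a[symmetric] by (intro sum.cong refl weight_eq)
  also have "\<dots> = (\<Sum>j\<in>{1..n}. (d j * a j)\<^sup>2 / D j) + (\<Sum>j\<in>{n+1..p}. (d j * a j)\<^sup>2 / D j)"
    unfolding split by (rule sum.union_disjoint) auto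
  also have "(\<Sum>j\<in>{1..n}. (d j * a j)\<^sup>2 / D j) = M\<^sup>2 * W"
    unfolding W_def sum_distrib_left by (intro sum.cong refl) (simp only: lo times_divide_eq_right mult_1_right)
  also have "(\<Sum>j\<in>{n+1..p}. (d j * a j)\<^sup>2 / D j) = lam\<^sup>2 * ?S"
    unfolding sum_distrib_left
  proof (intro sum.cong refl)
    fix j assume j: "j \<in> {n+1..p}"
    show "(d j * a j)\<^sup>2 / D j = lam\<^sup>2 * D j"
      unfolding hi[OF j] using D_pos[of j] j by (simp add: power2_eq_square)
  qed
  finally have Teq: "T = M\<^sup>2 * W + lam\<^sup>2 * ?S" .
  have TC: "T = lam * C" using C_pos by (simp add: lam_def)
  have "M\<^sup>2 * W = lam * (real n - 2) * M"
    using Teq unfolding TC Ceq by (simp add: power2_eq_square algebra_simps)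
  then have MW: "M * W = lam * (real n - 2)"
    using M_pos by (simp add: power2_eq_square)
  then have Mval: "M = lam * ((real n - 2) / W)" using W0 by (simp add: field_simps)
  have "C\<^sup>2 / T = C / lam" unfolding TC using C_pos lam_pos by (simp add: power2_eq_square)
  also have "\<dots> = (real n - 2)\<^sup>2 / W + ?S"
    unfolding Ceq Mval using lam_pos by (simp add: field_simps power2_eq_square)
  finally show "C\<^sup>2 / T = (real n - 2)\<^sup>2 / W + (\<Sum>j\<in>{n+1..p}. D j)" .
  have "lam * ((real n - 2) / W) \<le> lam * D n" using Mn unfolding Mval .
  then have "(real n - 2) / W \<le> D n" using lam_pos by (rule mult_left_le_imp_le)
  then show "real n - 2 \<le> D n * W" using W0 by (simp add: field_simps)
qed

end

subsection \<open>The risk bounds\<close>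

theorem theorem3:
  fixes p :: nat and d \<gamma> a :: "nat \<Rightarrow> real"
  assumes p3: "p \<ge> 3"
    and dpos: "\<forall>j\<in>{1..p}. d j > 0"
    and gnn: "\<forall>j\<in>{1..p}. \<gamma> j \<ge> 0"
    and sorted: "\<forall>i j. 1 \<le> i \<longrightarrow> i \<le> j \<longrightarrow> j \<le> p \<longrightarrow> dstar d \<gamma> j \<le> dstar d \<gamma> i"
    and a_feas: "feasible p d \<gamma> a"
    and a_max: "\<forall>b. feasible p d \<gamma> b \<longrightarrow> cstar p d b \<le> cstar p d a"
    and a_uniq: "\<forall>b. feasible p d \<gamma> b \<longrightarrow> cstar p d b = cstar p d a \<longrightarrow> (\<forall>j\<in>{1..p}. b j = a j)"
  shows "(nu_idx p d a = 3 \<longrightarrow>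
            bayes_risk p d \<gamma> (delta_A p d a) \<le>
              ennreal ((\<Sum>j\<in>{1..p}. d j) - (\<Sum>j\<in>{3..p}. dstar d \<gamma> j)
                + (dstar d \<gamma> 3 - 2 / (real p - 2) * (\<Sum>j\<in>{4..p}. dstar d \<gamma> j)
                   - real p / (real p - 2) * (dstar d \<gamma> 3 / 3)))
          \<and> (\<Sum>j\<in>{1..p}. d j) - (\<Sum>j\<in>{3..p}. dstar d \<gamma> j)
                + (dstar d \<gamma> 3 - 2 / (real p - 2) * (\<Sum>j\<in>{4..p}. dstar d \<gamma> j)
                   - real p / (real p - 2) * (dstar d \<gamma> 3 / 3))
            \<le> (\<Sum>j\<in>{1..p}. d j) - (\<Sum>j\<in>{3..p}. dstar d \<gamma> j) + 2 / 3 * dstar d \<gamma> 3)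
       \<and> (nu_idx p d a \<ge> 4 \<longrightarrow>
            bayes_risk p d \<gamma> (delta_A p d a) \<le>
              ennreal ((\<Sum>j\<in>{1..p}. d j) - (\<Sum>j\<in>{3..p}. dstar d \<gamma> j)
                + (dstar d \<gamma> 3 + dstar d \<gamma> 4 - 2 / (real p - 2) * (\<Sum>j\<in>{5..p}. dstar d \<gamma> j)
                   - 4 * real p / (real p - 2) * (dstar d \<gamma> (nu_idx p d a) / real (nu_idx p d a))))
          \<and> (\<Sum>j\<in>{1..p}. d j) - (\<Sum>j\<in>{3..p}. dstar d \<gamma> j)
                + (dstar d \<gamma> 3 + dstar d \<gamma> 4 - 2 / (real p - 2) * (\<Sum>j\<in>{5..p}. dstar d \<gamma> j)
                   - 4 * real p / (real p - 2) * (dstar d \<gamma> (nu_idx p d a) / real (nu_idx p d a)))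
            \<le> (\<Sum>j\<in>{1..p}. d j) - (\<Sum>j\<in>{3..p}. dstar d \<gamma> j) + (dstar d \<gamma> 3 + dstar d \<gamma> 4))"
proof -
  interpret cstar_maximizer p d \<gamma> a
    by unfold_locales (use p3 dpos gnn a_feas a_max in auto)
  let ?n = "nu_idx p d a"
  \<comment> \<open>In \<open>r = 1 + 2 / (p - 2)\<close> the 1 rebuilds the sum of the
    \<open>D j\<close> subtracted from the trace, and the excess gives the correction terms with
    \<open>2 / (p - 2)\<close>.\<close>
  define r where "r = real p / (real p - 2)"
  have r1: "r = 1 + 2 / (real p - 2)" and r_ge: "r \<ge> 1" and p2: "2 / (real p - 2) \<ge> 0"
    using p3 by (auto simp: r_def field_simps)
  have anti: "D j \<le> D i" if "1 \<le> i" "i \<le> j" "j \<le> p" for i j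
    using sorted that by blast
  have "bayes_risk p d \<gamma> (delta_A p d a) \<le> ennreal ((\<Sum>j\<in>{1..p}. d j) - C\<^sup>2 * (real p / ((real p - 2) * N a)))"
    by (rule bayes_risk_delta_A_le) (use p3 dpos gnn a_pos C_pos in auto)
  also have "C\<^sup>2 * (real p / ((real p - 2) * N a)) = r * (C\<^sup>2 / T)"
    unfolding N_a r_def by (simp add: mult.commute)
  finally have risk: "bayes_risk p d \<gamma> (delta_A p d a) \<le> ennreal ((\<Sum>j\<in>{1..p}. d j) - r * (C\<^sup>2 / T))" .
  have n_le: "?n \<le> p" using nu_idx_props(1) by simp
  note opt_value = maximizer_value(1)[OF anti] and slope = maximizer_value(2)[OF anti]
  have head: "(\<Sum>j\<in>{m..p}. D j) = D m + (\<Sum>j\<in>{Suc m..p}. D j)" if "m \<le> p" for m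
    using that by (rule sum.atLeast_Suc_atMost)
  have case3: ?thesis if n: "?n = 3"
  proof -
    have D3: "D 3 > 0" using p3 by (intro D_pos) auto
    define W where "W = (\<Sum>j\<in>{1..3::nat}. 1 / D j)"
    define S where "S = (\<Sum>j\<in>{4..p}. D j)"
    have S0: "S \<ge> 0" unfolding S_def by (intro sum_nonneg less_imp_le D_pos) auto
    have W0: "W > 0" unfolding W_def using p3 by (intro sum_pos divide_pos_pos D_pos) auto
    \<comment> \<open>The three reciprocals are each at most \<open>1 / D 3\<close>; since
      \<open>(3 - 2)\<^sup>2 = 1\<close>, this is the source of the term
      \<open>D 3 / 3\<close>.\<close>
    have "W \<le> (\<Sum>j\<in>{1..3::nat}. 1 / D 3)"
      unfolding W_def using p3 by (intro sum_mono frac_le D_pos anti) auto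
    then have "D 3 / 3 \<le> 1 / W" using W0 D3 by (simp add: field_simps)
    moreover have "C\<^sup>2 / T = 1 / W + S"
      using opt_value n by (simp add: W_def S_def)
    ultimately have "r * (D 3 / 3 + S) \<le> r * (C\<^sup>2 / T)"
      using r_ge by (intro mult_left_mono) auto
    moreover have "(\<Sum>j\<in>{3..p}. D j) = D 3 + S" using head[of 3] p3 by (simp add: S_def)
    moreover have "r * (D 3 / 3 + S) = r * (D 3 / 3) + S + 2 / (real p - 2) * S"
      by (simp add: r1 algebra_simps)
    ultimately have le: "(\<Sum>j\<in>{1..p}. d j) - r * (C\<^sup>2 / T) \<le>
        (\<Sum>j\<in>{1..p}. d j) - (\<Sum>j\<in>{3..p}. D j) + (D 3 - 2 / (real p - 2) * S - r * (D 3 / 3))"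
      by linarith
    have "2 / (real p - 2) * S \<ge> 0" using p2 S0 by (rule mult_nonneg_nonneg)
    moreover have "r * (D 3 / 3) \<ge> 1 * (D 3 / 3)" using r_ge D3 by (intro mult_right_mono) auto
    ultimately have le2: "(\<Sum>j\<in>{1..p}. d j) - (\<Sum>j\<in>{3..p}. D j) + (D 3 - 2 / (real p - 2) * S - r * (D 3 / 3)) \<le>
        (\<Sum>j\<in>{1..p}. d j) - (\<Sum>j\<in>{3..p}. D j) + 2 / 3 * D 3"
      by linarith
    show ?thesis
      using order_trans[OF risk ennreal_leI[OF le]] le2 n unfolding S_def r_def by simp
  qed
  have case4: ?thesis if n: "?n \<ge> 4"
  proof -
    define W where "W = (\<Sum>j\<in>{1..?n}. 1 / D j)"
    define S where "S = (\<Sum>j\<in>{5..p}. D j)"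
    define q where "q = D ?n / real ?n"
    have S0: "S \<ge> 0" unfolding S_def by (intro sum_nonneg less_imp_le D_pos) auto
    have q0: "q \<ge> 0" unfolding q_def by (intro divide_nonneg_nonneg less_imp_le D_pos nu_idx_props) (use n in simp)
    \<comment> \<open>The harmonic bound is taken at \<open>k = n = ?n\<close>, with
      \<open>slope\<close> supplying its hypothesis on the last index.\<close>
    have "(\<Sum>j\<in>{5..?n}. D j) + 4 * D ?n / real ?n \<le> (real ?n - 2)\<^sup>2 / W"
      unfolding W_def using n n_le slope
      by (intro harmonic_sum_bound[where n="?n"] D_pos anti) auto
    moreover have "S = (\<Sum>j\<in>{5..?n}. D j) + (\<Sum>j\<in>{?n+1..p}. D j)"
    proof -
      have "{5..p} = {5..?n} \<union> {?n+1..p}" using n n_le by auto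
      then show ?thesis unfolding S_def by (simp only:) (rule sum.union_disjoint; auto)
    qed
    moreover have "C\<^sup>2 / T = (real ?n - 2)\<^sup>2 / W + (\<Sum>j\<in>{?n+1..p}. D j)"
      unfolding W_def by (rule opt_value)
    ultimately have "S + 4 * q \<le> C\<^sup>2 / T" by (simp add: q_def)
    then have "r * (S + 4 * q) \<le> r * (C\<^sup>2 / T)"
      using r_ge by (intro mult_left_mono) auto
    moreover have "(\<Sum>j\<in>{3..p}. D j) = D 3 + D 4 + S" using head[of 3] head[of 4] n n_le by (simp add: S_def)
    moreover have "r * (S + 4 * q) = S + 2 / (real p - 2) * S + 4 * (r * q)"
      by (simp add: r1 algebra_simps add_divide_distrib)
    ultimately have le: "(\<Sum>j\<in>{1..p}. d j) - r * (C\<^sup>2 / T) \<le>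
        (\<Sum>j\<in>{1..p}. d j) - (\<Sum>j\<in>{3..p}. D j) + (D 3 + D 4 - 2 / (real p - 2) * S - 4 * (r * q))"
      by linarith
    have "2 / (real p - 2) * S \<ge> 0" using p2 S0 by (rule mult_nonneg_nonneg)
    moreover have "r * q \<ge> 0" using r_ge q0 by simp
    ultimately have le2: "(\<Sum>j\<in>{1..p}. d j) - (\<Sum>j\<in>{3..p}. D j) + (D 3 + D 4 - 2 / (real p - 2) * S - 4 * (r * q)) \<le>
        (\<Sum>j\<in>{1..p}. d j) - (\<Sum>j\<in>{3..p}. D j) + (D 3 + D 4)"
      by linarith
    have "4 * (r * q) = 4 * real p / (real p - 2) * (D ?n / real ?n)"
      by (simp add: r_def q_def)
    then show ?thesis
      using order_trans[OF risk ennreal_leI[OF le]] le2 n unfolding S_def by simp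
  qed
  show ?thesis using case3 case4 by fastforce
qed

end
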